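(* Let $p$ be a nonnegative integer and let $L(\lambda(u))$ be the irreducible highest weight representation of the Yangian $\mathrm{Y}_p(\mathfrak{gl}_{1|1})$ of level $p$ (associated with the parity sequence $01$) with highest vector $\xi$ and highest weight $\lambda(u)=(\lambda_1(u),\lambda_2(u))$, where $$\lambda_1(u)=(u+\alpha_1)\cdots(u+\alpha_p),\qquad \lambda_2(u)=(u+\beta_1)\cdots(u+\beta_p),\qquad \alpha_i,\beta_i\in\mathbb{C}.$$ Assume that $\alpha_i\neq\beta_j$ for all $i,j\in\{1,\dots,p\}$, and that $\alpha_i-\alpha_j+1\neq 0$ for all $1\leqslant i<j\leqslant p$. Then the vector $$\zeta=T_{21}(-\alpha_1)\cdots T_{21}(-\alpha_p)\,\xi\in L(\lambda(u))$$ is nonzero. Moreover, the following relations hold: $$T_{11}(u)\,\zeta=(u+\alpha_1-1)\cdots(u+\alpha_p-1)\,\zeta,$$ $$T_{22}(u)\,\zeta=(u+\beta_1-1)\cdots(u+\beta_p-1)\,\zeta,$$ $$T_{21}(u)\,\zeta=0.$$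
   Context: The Yangian $\mathrm{Y}(\mathfrak{gl}_{1|1})$ associated with the parity sequence $01$ is the unital associative $\mathbb{Z}_2$-graded algebra over $\mathbb{C}$ with generators $t_{ij}^{(r)}$, $1\leqslant i,j\leqslant 2$, $r=1,2,\dots$, where $t_{ij}^{(r)}$ has parity $\bar\imath+\bar\jmath \bmod 2$ with $\bar 1=0$, $\bar 2=1$. Put $t_{ij}(u)=\delta_{ij}+\sum_{r\geqslant 1}t_{ij}^{(r)}u^{-r}$. The defining relations are $$[t_{ij}(u),t_{kl}(v)]=\frac{1}{u-v}\big(t_{kj}(u)t_{il}(v)-t_{kj}(v)t_{il}(u)\big)(-1)^{\bar\imath\bar\jmath+\bar\imath\bar k+\bar\jmath\bar k},$$ where $[a,b]=ab-(-1)^{|a||b|}ba$ is the super-commutator on homogeneous elements, $|a|$ being the parity of $a$. The Yangian of level $p$, $\mathrm{Y}_p(\mathfrak{gl}_{1|1})$, is the quotient of $\mathrm{Y}(\mathfrak{gl}_{1|1})$ by the two-sided ideal generated by all $t_{ij}^{(r)}$ with $r>p$. In it, set $$T_{ij}(u)=u^p t_{ij}(u)=\delta_{ij}u^p+t_{ij}^{(1)}u^{p-1}+\dots+t_{ij}^{(p)},$$ which are polynomials in $u$ and may be evaluated at complex numbers. A representation $V$ of $\mathrm{Y}_p(\mathfrak{gl}_{1|1})$ is a highest weight representation with highest weight $(\lambda_1(u),\lambda_2(u))$, where $\lambda_1(u),\lambda_2(u)$ are monic polynomials in $u$ of degree $p$, if it is generated by a nonzero vector $\xi$ (the highest vector)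 with $T_{12}(u)\xi=0$ and $T_{ii}(u)\xi=\lambda_i(u)\xi$ for $i=1,2$. The Verma module $M(\lambda(u))$ is the quotient of the algebra by the left ideal generated by all coefficients of $T_{12}(u)$ and $T_{ii}(u)-\lambda_i(u)$, $i=1,2$; $L(\lambda(u))$ denotes its irreducible quotient, and $\xi$ is the image of $1$. *)

theory Defs
  imports
    "HOL-Library.Poly_Mapping"
    "HOL-Computational_Algebra.Polynomial"
    "HOL-Algebra.Algebraic_Closure_Type"
    "HOL-Algebra.Module"
begin

text \<open>
  The free associative algebra over the complex numbers on a set of letters is the monoid
  algebra of the free monoid, with \<^const>\<open>Poly_Mapping.single\<close> 0 c as the scalar c.
\<close>

datatype 'a word = Word "'a list"

instantiation word :: (type) monoid_add
begin

definition zero_word :: "'a word" where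
  "0 = Word []"

fun plus_word :: "'a word \<Rightarrow> 'a word \<Rightarrow> 'a word" where
  "Word xs + Word ys = Word (xs @ ys)"

instance
proof
  fix a b c :: "'a word"
  show "a + b + c = a + (b + c)" by (cases a; cases b; cases c) simp
  show "0 + a = a" by (cases a) (simp add: zero_word_def)
  show "a + 0 = a" by (cases a) (simp add: zero_word_def)
qed

end

type_synonym 'a free_alg = "'a word \<Rightarrow>\<^sub>0 complex"


section \<open>The Yangian of gl(1|1)\<close>

datatype idx = I1 | I2

fun par :: "idx \<Rightarrow> nat" where
  "par I1 = 0"
| "par I2 = 1"

text \<open>\<open>Gen i j n\<close> is the generator with upper index n + 1, so that the generators are
  exactly those with upper index r at least 1.\<close>
datatype gen = Gen idx idx nat

text \<open>The coefficient of the (-r)-th power of u in the series \<open>t_ij(u)\<close>.\<close>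
definition t_free :: "idx \<Rightarrow> idx \<Rightarrow> nat \<Rightarrow> gen free_alg" where
  "t_free i j r =
     (case r of 0 \<Rightarrow> (if i = j then 1 else 0)
              | Suc n \<Rightarrow> Poly_Mapping.single (Word [Gen i j n]) 1)"

text \<open>The super-commutator of the r-th coefficient of \<open>t_ij(u)\<close>, of parity \<open>par i + par j\<close>,
  and the s-th coefficient of \<open>t_kl(v)\<close>.\<close>
definition t_scomm :: "idx \<Rightarrow> idx \<Rightarrow> nat \<Rightarrow> idx \<Rightarrow> idx \<Rightarrow> nat \<Rightarrow> gen free_alg" where
  "t_scomm i j r k l s =
     t_free i j r * t_free k l s
     - (- 1) ^ ((par i + par j) * (par k + par l)) * (t_free k l s * t_free i j r)"

text \<open>
  The coefficient at \<open>u\<close> to the power -r and \<open>v\<close> to the power -s of the defining relation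
  multiplied by \<open>u - v\<close>. The coefficients involving the first power of u or of v vanish
  identically, because the constant term of \<open>t_ij(u)\<close> is 0 or 1.
\<close>
definition yangian_relator :: "idx \<Rightarrow> idx \<Rightarrow> idx \<Rightarrow> idx \<Rightarrow> nat \<Rightarrow> nat \<Rightarrow> gen free_alg" where
  "yangian_relator i j k l r s =
     (t_scomm i j (Suc r) k l s - t_scomm i j r k l (Suc s))
     - (- 1) ^ (par i * par j + par i * par k + par j * par k)
       * (t_free k j r * t_free i l s - t_free k j s * t_free i l r)"

abbreviation free_ring :: "gen free_alg ring" where
  "free_ring \<equiv> ring_of_type_algebra"

definition yangian_ideal :: "gen free_alg set" where
  "yangian_ideal = Idl\<^bsub>free_ring\<^esub> {yangian_relator i j k l r s | i j k l r s. True}"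

definition yangian :: "gen free_alg set ring" where
  "yangian = free_ring Quot yangian_ideal"

definition yangian_proj :: "gen free_alg \<Rightarrow> gen free_alg set" where
  "yangian_proj x = yangian_ideal +>\<^bsub>free_ring\<^esub> x"

definition level_ideal :: "nat \<Rightarrow> gen free_alg set set" where
  "level_ideal p = Idl\<^bsub>yangian\<^esub> {yangian_proj (t_free i j r) | i j r. r > p}"

type_synonym yp = "gen free_alg set set"

definition Yp :: "nat \<Rightarrow> yp ring" where
  "Yp p = yangian Quot level_ideal p"

definition Yp_proj :: "nat \<Rightarrow> gen free_alg \<Rightarrow> yp" where
  "Yp_proj p x = level_ideal p +>\<^bsub>yangian\<^esub> yangian_proj x"

definition Yp_scalar :: "nat \<Rightarrow> complex \<Rightarrow> yp" where
  "Yp_scalar p c = Yp_proj p (Poly_Mapping.single 0 c)"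

text \<open>The coefficient of the k-th power of u in \<open>T_ij(u)\<close>.\<close>
definition T_coeff :: "nat \<Rightarrow> idx \<Rightarrow> idx \<Rightarrow> nat \<Rightarrow> yp" where
  "T_coeff p i j k = (if k \<le> p then Yp_proj p (t_free i j (p - k)) else \<zero>\<^bsub>Yp p\<^esub>)"

definition T_eval :: "nat \<Rightarrow> idx \<Rightarrow> idx \<Rightarrow> complex \<Rightarrow> yp" where
  "T_eval p i j c =
     (\<Oplus>\<^bsub>Yp p\<^esub> k \<in> {..p}. Yp_scalar p (c ^ k) \<otimes>\<^bsub>Yp p\<^esub> T_coeff p i j k)"


section \<open>Left modules\<close>

text \<open>
  The locale \<^locale>\<open>module\<close> requires a commutative ring of scalars; its record type and the
  locale \<^locale>\<open>submodule\<close> do not, and are used here for left modules over an arbitrary ring.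
  The fields \<open>mult\<close> and \<open>one\<close> of the record play no role.
\<close>

definition regular_module :: "('a, 'b) ring_scheme \<Rightarrow> ('a, 'a) module" where
  "regular_module R =
     \<lparr>carrier = carrier R, monoid.mult = monoid.mult R, one = one R, zero = zero R, add = add R,
      module.smult = monoid.mult R\<rparr>"

definition quot_module :: "('a, 'b) module \<Rightarrow> 'b set \<Rightarrow> ('a, 'b set) module" where
  "quot_module M N =
     \<lparr>carrier = a_rcosets\<^bsub>M\<^esub> N, monoid.mult = undefined, one = undefined,
      zero = N, add = set_add M,
      module.smult = (\<lambda>a A. \<Union>x\<in>A. N +>\<^bsub>M\<^esub> (a \<odot>\<^bsub>M\<^esub> x))\<rparr>"

definition left_ideal_gen :: "('a, 'b) ring_scheme \<Rightarrow> 'a set \<Rightarrow> 'a set" where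
  "left_ideal_gen R S = \<Inter>{J. submodule J R (regular_module R) \<and> S \<subseteq> J}"

definition irreducible_module :: "('a, 'c) ring_scheme \<Rightarrow> ('a, 'b) module \<Rightarrow> bool" where
  "irreducible_module R V \<longleftrightarrow>
     carrier V \<noteq> {\<zero>\<^bsub>V\<^esub>} \<and>
     (\<forall>W. submodule W R V \<longrightarrow> W = {\<zero>\<^bsub>V\<^esub>} \<or> W = carrier V)"

text \<open>\<open>T_ij(u) v = f(u) v\<close>, as an identity of polynomials in u with coefficients in V.\<close>
definition T_acts :: "nat \<Rightarrow> (yp, 'v) module \<Rightarrow> idx \<Rightarrow> idx \<Rightarrow> complex poly \<Rightarrow> 'v \<Rightarrow> bool" where
  "T_acts p V i j f v \<longleftrightarrow>
     (\<forall>k. T_coeff p i j k \<odot>\<^bsub>V\<^esub> v = Yp_scalar p (poly.coeff f k) \<odot>\<^bsub>V\<^esub> v)"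


section \<open>Verma modules\<close>

definition verma_ideal :: "nat \<Rightarrow> complex poly \<Rightarrow> complex poly \<Rightarrow> yp set" where
  "verma_ideal p lam1 lam2 =
     left_ideal_gen (Yp p)
       (range (T_coeff p I1 I2)
        \<union> range (\<lambda>k. T_coeff p I1 I1 k \<ominus>\<^bsub>Yp p\<^esub> Yp_scalar p (poly.coeff lam1 k))
        \<union> range (\<lambda>k. T_coeff p I2 I2 k \<ominus>\<^bsub>Yp p\<^esub> Yp_scalar p (poly.coeff lam2 k)))"

definition verma :: "nat \<Rightarrow> complex poly \<Rightarrow> complex poly \<Rightarrow> (yp, yp set) module" where
  "verma p lam1 lam2 = quot_module (regular_module (Yp p)) (verma_ideal p lam1 lam2)"

text \<open>The image of 1 in the Verma module.\<close>
definition verma_vec :: "nat \<Rightarrow> complex poly \<Rightarrow> complex poly \<Rightarrow> yp set" where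
  "verma_vec p lam1 lam2 =
     verma_ideal p lam1 lam2 +>\<^bsub>regular_module (Yp p)\<^esub> \<one>\<^bsub>Yp p\<^esub>"

text \<open>
  L together with xi is the irreducible quotient of the Verma module with the image of 1,
  presented as the quotient by a submodule N.
\<close>
definition irreducible_quotient_of_verma ::
  "nat \<Rightarrow> complex poly \<Rightarrow> complex poly \<Rightarrow> (yp, yp set set) module \<Rightarrow> yp set set \<Rightarrow> bool" where
  "irreducible_quotient_of_verma p lam1 lam2 L \<xi> \<longleftrightarrow>
     (\<exists>N. submodule N (Yp p) (verma p lam1 lam2)
        \<and> L = quot_module (verma p lam1 lam2) N
        \<and> irreducible_module (Yp p) L
        \<and> \<xi> = N +>\<^bsub>verma p lam1 lam2\<^esub> verma_vec p lam1 lam2)"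

end

theory Submission
  imports Defs
begin

text \<open>
  Write \<open>\<xi>\<close> for the highest vector, \<open>\<lambda>\<^sub>1\<close>, \<open>\<lambda>\<^sub>2\<close> for its eigenvalues, and
  \<open>\<eta>\<^sub>k = T\<^sub>2\<^sub>1(-\<alpha>\<^sub>k\<^sub>+\<^sub>1) ... T\<^sub>2\<^sub>1(-\<alpha>\<^sub>p) \<xi>\<close>, so that \<open>\<eta>\<^sub>p = \<xi>\<close> and \<open>\<eta>\<^sub>0 = \<zeta>\<close>.

  The commutation relation
  \<open>(u - w) T\<^sub>1\<^sub>1(u) T\<^sub>2\<^sub>1(w) = (u - w - 1) T\<^sub>2\<^sub>1(w) T\<^sub>1\<^sub>1(u) + T\<^sub>2\<^sub>1(u) T\<^sub>1\<^sub>1(w)\<close> shows that, if \<open>x\<close> is an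
  eigenvector of \<open>T\<^sub>1\<^sub>1(u)\<close> whose eigenvalue vanishes at \<open>w\<close>, then \<open>T\<^sub>2\<^sub>1(w) x\<close> is again an eigenvector, and
  the factor \<open>u - w\<close> of the eigenvalue becomes \<open>u - w - 1\<close> (\<open>T11_lowered\<close>). This settles the
  action of \<open>T\<^sub>1\<^sub>1\<close> on all \<open>\<eta>\<^sub>k\<close>. The operators \<open>T\<^sub>2\<^sub>2(u)\<close> have no such property; in their place one uses
  \<open>Q(v) = T\<^sub>1\<^sub>1(v + 1) T\<^sub>2\<^sub>2(v) - T\<^sub>2\<^sub>1(v + 1) T\<^sub>1\<^sub>2(v)\<close>, which also equals
  \<open>T\<^sub>2\<^sub>2(v + 1) T\<^sub>1\<^sub>1(v) + T\<^sub>1\<^sub>2(v + 1) T\<^sub>2\<^sub>1(v)\<close>. By the first form \<open>\<xi>\<close> is an eigenvector of \<open>Q(v)\<close>, and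
  by an identity for \<open>Q(v) T\<^sub>2\<^sub>1(w)\<close> (\<open>Q_T21\<close>) so is every \<open>\<eta>\<^sub>k\<close>.

  The second form of \<open>Q\<close> is used twice. Evaluated at \<open>w = -\<alpha>\<^sub>k\<close>, where \<open>T\<^sub>1\<^sub>1(w)\<close> kills \<open>\<eta>\<^sub>k\<close>, it
  says that \<open>T\<^sub>1\<^sub>2(w + 1) \<eta>\<^sub>k\<^sub>-\<^sub>1\<close> is a multiple of \<open>\<eta>\<^sub>k\<close>, and the factor is up to sign a
  product of numbers \<open>\<beta>\<^sub>j - \<alpha>\<^sub>k\<close> and \<open>\<alpha>\<^sub>i - \<alpha>\<^sub>j + 1\<close> with \<open>i < j\<close> and \<open>k \<in> {i, j}\<close>; so \<open>\<eta>\<^sub>k\<^sub>-\<^sub>1\<close> is nonzero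
  whenever \<open>\<eta>\<^sub>k\<close> is (\<open>\<eta>_nonzero\<close>). Applied to \<open>\<zeta>\<close>, on which \<open>T\<^sub>2\<^sub>1\<close> vanishes, it expresses
  \<open>T\<^sub>2\<^sub>2(v + 1) \<zeta>\<close> through the known eigenvalues of \<open>Q(v)\<close> and \<open>T\<^sub>1\<^sub>1(v)\<close> (\<open>T22_full_\<eta>\<close>).

  That \<open>T\<^sub>2\<^sub>1(u) \<zeta> = 0\<close> holds because every product of \<open>p + 1\<close> operators \<open>T\<^sub>2\<^sub>1\<close> is zero
  (\<open>T21_lowering_eq_0\<close>): since \<open>T\<^sub>2\<^sub>1(v + 1) T\<^sub>2\<^sub>1(v) = 0\<close>, for generic \<open>v\<^sub>1, ..., v\<^sub>p\<close> the polynomial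
  \<open>T\<^sub>2\<^sub>1(u) T\<^sub>2\<^sub>1(v\<^sub>1) ... T\<^sub>2\<^sub>1(v\<^sub>p)\<close> of degree below \<open>p\<close> in \<open>u\<close> has the \<open>p\<close> distinct zeros \<open>v\<^sub>i + 1\<close>,
  and the general case follows by polynomial continuation.

  All of this takes place in the locale \<open>yangian_rep\<close>, whose vectors form a type. The module \<open>L\<close>, whose
  vectors only form a set, is brought there as follows: acting on \<open>\<xi>\<close> gives a linear map \<open>\<rho>\<close> from the
  free algebra to \<open>L\<close>, a projection \<open>\<pi>\<close> of the free algebra with the same kernel as \<open>\<rho>\<close> selects one
  representative of every value of \<open>\<rho>\<close>, and the generators act on the free algebra by multiplication
  followed by \<open>\<pi>\<close>. This makes the free algebra a representation of the Yangian of level \<open>p\<close>, and \<open>\<rho>\<close> an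
  intertwiner that is injective on the range of \<open>\<pi>\<close> (\<open>T_acts_\<rho>_iff\<close>).
\<close>

section \<open>Representations of the Yangian of level p on a vector space\<close>

text \<open>
  With \<open>t(u) = a\<^sub>0 u\<^sup>p + ... + a\<^sub>p\<close>, shifting the coefficients is multiplication by \<open>u\<close> as long as
  nothing is lost at either end. This passes from relations between coefficients to relations
  between polynomials.
\<close>
lemma sum_shift_coeff:
  fixes a :: "nat \<Rightarrow> complex"
  assumes "a 0 = 0" "a (Suc p) = 0"
  shows "(\<Sum>k\<le>p. u ^ k * a (Suc (p - k))) = u * (\<Sum>k\<le>p. u ^ k * a (p - k))"
proof (cases p)
  case 0
  then show ?thesis using assms by simp
next
  case (Suc q)
  have "(\<Sum>k\<le>Suc q. u ^ k * a (Suc (Suc q - k))) = (\<Sum>k\<le>q. u ^ Suc k * a (Suc (q - k)))"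
    using assms(2) Suc by (simp add: sum.atMost_Suc_shift del: sum.atMost_Suc)
  also have "\<dots> = u * (\<Sum>k\<le>q. u ^ k * a (Suc q - k))"
    by (simp add: sum_distrib_left mult.assoc Suc_diff_le)
  also have "\<dots> = u * (\<Sum>k\<le>Suc q. u ^ k * a (Suc q - k))"
    using assms(1) by simp
  finally show ?thesis using Suc by simp
qed

lemma poly_sum_monom: "poly (\<Sum>k\<le>n. monom (a k) k) u = (\<Sum>k\<le>n. u ^ k * a k)"
  for u :: complex
  by (simp add: poly_sum poly_monom mult.commute)

text \<open>
  \<open>t i j r\<close> is the action of the generator \<open>t_ij\<close> with upper index \<open>r\<close>; as in the series
  \<open>t_ij(u)\<close>, the index 0 stands for the constant term.
\<close>
locale yangian_rep = vector_space scale
  for scale :: "complex \<Rightarrow> 'v::ab_group_add \<Rightarrow> 'v" (infixr \<open>*s\<close> 75) +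
  fixes p :: nat and t :: "idx \<Rightarrow> idx \<Rightarrow> nat \<Rightarrow> 'v \<Rightarrow> 'v"
  assumes t_linear: "Vector_Spaces.linear scale scale (t i j r)"
    and t_0: "t i j 0 x = (if i = j then x else 0)"
    and t_above_level: "r > p \<Longrightarrow> t i j r x = 0"
    and t_relation:
      "(t i j (Suc r) (t k l s x) - (-1) ^ ((par i + par j) * (par k + par l)) *s t k l s (t i j (Suc r) x))
       - (t i j r (t k l (Suc s) x) - (-1) ^ ((par i + par j) * (par k + par l)) *s t k l (Suc s) (t i j r x))
       = (-1) ^ (par i * par j + par i * par k + par j * par k)
         *s (t k j r (t i l s x) - t k j s (t i l r x))"
begin

definition linear_form :: "('v \<Rightarrow> complex) \<Rightarrow> bool" where
  "linear_form \<phi> \<longleftrightarrow> Vector_Spaces.linear scale (*) \<phi>"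

definition T :: "idx \<Rightarrow> idx \<Rightarrow> complex \<Rightarrow> 'v \<Rightarrow> 'v" where
  "T i j u x = (\<Sum>k\<le>p. u ^ k *s t i j (p - k) x)"

lemma vector_space_pair_complex: "vector_space_pair scale ((*) :: complex \<Rightarrow> complex \<Rightarrow> complex)"
  by unfold_locales (auto simp: algebra_simps)

lemma linear_formD:
  assumes "linear_form \<phi>"
  shows "\<phi> (x + y) = \<phi> x + \<phi> y" "\<phi> (x - y) = \<phi> x - \<phi> y" "\<phi> (c *s x) = c * \<phi> x"
    "\<phi> 0 = 0" "\<phi> (sum f A) = (\<Sum>a\<in>A. \<phi> (f a))"
proof -
  interpret \<phi>: module_hom scale "(*)" \<phi>
    using assms unfolding linear_form_def module_hom_iff_linear .
  show "\<phi> (x + y) = \<phi> x + \<phi> y" "\<phi> (x - y) = \<phi> x - \<phi> y" "\<phi> (c *s x) = c * \<phi> x"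
    "\<phi> 0 = 0" "\<phi> (sum f A) = (\<Sum>a\<in>A. \<phi> (f a))"
    by (simp_all add: \<phi>.add \<phi>.diff \<phi>.scale \<phi>.sum)
qed

lemma linear_form_t: "linear_form \<phi> \<Longrightarrow> linear_form (\<lambda>x. \<phi> (t i j r x))"
  using Vector_Spaces.linear_compose[OF t_linear] unfolding linear_form_def o_def .

lemma linear_formI:
  assumes "\<And>x y. \<phi> (x + y) = \<phi> x + \<phi> y" "\<And>c x. \<phi> (c *s x) = c * \<phi> x"
  shows "linear_form \<phi>"
  unfolding linear_form_def Vector_Spaces.linear_iff using assms
  by (simp add: vector_space_pair_complex[unfolded vector_space_pair_def])

lemma form_T:
  assumes \<phi>: "linear_form \<phi>"
  shows "\<phi> (T i j u x) = (\<Sum>k\<le>p. u ^ k * \<phi> (t i j (p - k) x))"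
  by (simp add: T_def linear_formD[OF \<phi>])

lemma linear_form_T:
  assumes \<phi>: "linear_form \<phi>"
  shows "linear_form (\<lambda>x. \<phi> (T i j u x))"
proof (rule linear_formI)
  note \<phi>t = linear_formD[OF linear_form_t[OF \<phi>]]
  show "\<phi> (T i j u (x + y)) = \<phi> (T i j u x) + \<phi> (T i j u y)" for x y
    by (simp add: form_T[OF \<phi>] \<phi>t(1) distrib_left sum.distrib)
  show "\<phi> (T i j u (c *s x)) = c * \<phi> (T i j u x)" for c x
    unfolding form_T[OF \<phi>] \<phi>t(3) sum_distrib_left by (intro sum.cong) simp_all
qed

text \<open>
  Linear forms separate vectors. Linear consequences of the commutation relations thus become
  identities between complex numbers, where ring normalisation and Groebner bases apply, and
  vectors that depend polynomially on a parameter become polynomials.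
\<close>
lemma eq_by_linear_forms:
  assumes "\<And>\<phi>. linear_form \<phi> \<Longrightarrow> \<phi> x = \<phi> y"
  shows "x = y"
proof (rule ccontr)
  assume "x \<noteq> y"
  then have "independent {x - y}"
    using dependent_single by auto
  from vector_space_pair.linear_independent_extend[OF vector_space_pair_complex this, of "\<lambda>_. 1"]
  obtain \<phi> where \<phi>: "linear_form \<phi>" "\<phi> (x - y) = 1"
    unfolding linear_form_def by blast
  then show False
    using assms[OF \<phi>(1)] \<phi>(2) by (simp add: linear_formD[OF \<phi>(1)])
qed

lemma linear_T: "Vector_Spaces.linear scale scale (T i j u)"
proof -
  have "T i j u (x + y) = T i j u x + T i j u y" for x y
  proof (rule eq_by_linear_forms)
    fix \<phi> assume \<phi>: "linear_form \<phi>"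
    show "\<phi> (T i j u (x + y)) = \<phi> (T i j u x + T i j u y)"
      by (simp add: linear_formD[OF \<phi>] linear_formD[OF linear_form_T[OF \<phi>]])
  qed
  moreover have "T i j u (c *s x) = c *s T i j u x" for c x
  proof (rule eq_by_linear_forms)
    fix \<phi> assume \<phi>: "linear_form \<phi>"
    show "\<phi> (T i j u (c *s x)) = \<phi> (c *s T i j u x)"
      by (simp add: linear_formD[OF \<phi>] linear_formD[OF linear_form_T[OF \<phi>]])
  qed
  ultimately show ?thesis
    unfolding Vector_Spaces.linear_iff by (simp add: vector_space_axioms)
qed

lemma form_TT:
  assumes "linear_form \<phi>"
  shows "\<phi> (T i j u (T k l v x))
    = (\<Sum>a\<le>p. u ^ a * (\<Sum>b\<le>p. v ^ b * \<phi> (t i j (p - a) (t k l (p - b) x))))"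
  by (simp add: form_T[OF assms] form_T[OF linear_form_t[OF assms]])

text \<open>
  The defining relation for the polynomials \<open>T_ij(u)\<close>. Multiplying the coefficient relation by
  \<open>u\<close> and \<open>v\<close> to the powers \<open>p - r\<close> and \<open>p - s\<close> and summing over \<open>r, s \<le> p\<close> gives it, since
  super-commutators vanish when one of the upper indices is 0 or above the level.
\<close>
lemma T_relation:
  assumes \<phi>: "linear_form \<phi>"
  shows "(u - v) * (\<phi> (T i j u (T k l v x))
            - (-1) ^ ((par i + par j) * (par k + par l)) * \<phi> (T k l v (T i j u x)))
       = (-1) ^ (par i * par j + par i * par k + par j * par k)
         * (\<phi> (T k j u (T i l v x)) - \<phi> (T k j v (T i l u x)))"
proof -
  define \<epsilon> :: complex where "\<epsilon> = (-1) ^ ((par i + par j) * (par k + par l))"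
  define \<delta> :: complex where "\<delta> = (-1) ^ (par i * par j + par i * par k + par j * par k)"
  define f where "f r s = \<phi> (t i j r (t k l s x)) - \<epsilon> * \<phi> (t k l s (t i j r x))" for r s
  define g where "g r s = \<phi> (t k j r (t i l s x)) - \<phi> (t k j s (t i l r x))" for r s
  define S where "S h = (\<Sum>a\<le>p. u ^ a * (\<Sum>b\<le>p. v ^ b * h (p - a) (p - b)))"
    for h :: "nat \<Rightarrow> nat \<Rightarrow> complex"
  have S_diff: "S (\<lambda>r s. h r s - h' r s) = S h - S h'" for h h'
    by (simp add: S_def sum_subtractf right_diff_distrib)
  have S_scale: "S (\<lambda>r s. c * h r s) = c * S h" for h c
    by (simp add: S_def sum_distrib_left mult.left_commute)
  have swap: "S (\<lambda>r s. h s r) = (\<Sum>b\<le>p. v ^ b * (\<Sum>a\<le>p. u ^ a * h (p - b) (p - a)))" for h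
    unfolding S_def sum_distrib_left
    by (subst sum.swap) (simp add: mult.left_commute)
  have f_rel: "f (Suc r) s - f r (Suc s) = \<delta> * g r s" for r s
    using arg_cong[OF t_relation[of i j r k l s x], of \<phi>]
    by (simp add: linear_formD[OF \<phi>] f_def g_def \<epsilon>_def \<delta>_def)
  have f0: "f 0 s = 0" "f r 0 = 0" for r s
    by (cases i; cases j; cases k; cases l;
        simp add: f_def t_0 \<epsilon>_def linear_formD[OF \<phi>] linear_formD[OF linear_form_t[OF \<phi>]])+
  have fp: "f (Suc p) s = 0" "f r (Suc p) = 0" for r s
    by (simp_all add: f_def t_above_level linear_formD[OF \<phi>] linear_formD[OF linear_form_t[OF \<phi>]])
  have "S (\<lambda>r s. f (Suc r) s) = u * S f"
    unfolding S_def
    by (subst sum_shift_coeff[where a = "\<lambda>r. \<Sum>b\<le>p. v ^ b * f r (p - b)"]) (simp_all add: f0 fp)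
  moreover have "S (\<lambda>r s. f r (Suc s)) = v * S f"
    unfolding S_def
    by (subst sum_shift_coeff) (simp_all add: f0 fp sum_distrib_left mult.left_commute)
  ultimately have main: "(u - v) * S f = \<delta> * S g"
    using S_diff[of "\<lambda>r s. f (Suc r) s" "\<lambda>r s. f r (Suc s)"] S_scale[of \<delta> g]
    by (simp add: f_rel left_diff_distrib)
  have "S f = \<phi> (T i j u (T k l v x)) - \<epsilon> * \<phi> (T k l v (T i j u x))"
    unfolding f_def S_diff S_scale form_TT[OF \<phi>]
    using swap[of "\<lambda>s r. \<phi> (t k l s (t i j r x))"] by (simp add: S_def)
  moreover have "S g = \<phi> (T k j u (T i l v x)) - \<phi> (T k j v (T i l u x))"
    unfolding g_def S_diff form_TT[OF \<phi>]
    using swap[of "\<lambda>s r. \<phi> (t k j s (t i l r x))"] by (simp add: S_def)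
  ultimately show ?thesis
    using main by (simp add: \<epsilon>_def \<delta>_def)
qed

text \<open>
  The relation for \<open>T\<^sub>2\<^sub>2(u)\<close> and \<open>T\<^sub>2\<^sub>1(v)\<close> comes from the one for \<open>T\<^sub>2\<^sub>1(v)\<close> and \<open>T\<^sub>2\<^sub>2(u)\<close>, because this
  order leaves \<open>T\<^sub>2\<^sub>1\<close> as the left factor in the terms on the right.
\<close>
lemma
  assumes \<phi>: "linear_form \<phi>"
  shows T21_T21: "(u - v + 1) * \<phi> (T I2 I1 u (T I2 I1 v x)) = (v - u + 1) * \<phi> (T I2 I1 v (T I2 I1 u x))"
    and T11_T21: "(u - v) * \<phi> (T I1 I1 u (T I2 I1 v x))
      = (u - v - 1) * \<phi> (T I2 I1 v (T I1 I1 u x)) + \<phi> (T I2 I1 u (T I1 I1 v x))"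
    and T22_T21: "(u - v) * \<phi> (T I2 I2 u (T I2 I1 v x))
      = (u - v - 1) * \<phi> (T I2 I1 v (T I2 I2 u x)) + \<phi> (T I2 I1 u (T I2 I2 v x))"
    and T12_T21: "(u - v) * (\<phi> (T I1 I2 u (T I2 I1 v x)) + \<phi> (T I2 I1 v (T I1 I2 u x)))
      = \<phi> (T I2 I2 v (T I1 I1 u x)) - \<phi> (T I2 I2 u (T I1 I1 v x))"
    and T11_T22: "(u - v) * (\<phi> (T I1 I1 u (T I2 I2 v x)) - \<phi> (T I2 I2 v (T I1 I1 u x)))
      = \<phi> (T I2 I1 u (T I1 I2 v x)) - \<phi> (T I2 I1 v (T I1 I2 u x))"
  using T_relation[OF \<phi>, of u v I2 I1 I2 I1 x] T_relation[OF \<phi>, of u v I1 I1 I2 I1 x]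
    T_relation[OF \<phi>, of v u I2 I1 I2 I2 x] T_relation[OF \<phi>, of u v I1 I2 I2 I1 x]
    T_relation[OF \<phi>, of u v I1 I1 I2 I2 x]
  by (simp_all add: algebra_simps)

text \<open>
  Where \<open>T\<^sub>1\<^sub>1(v)\<close> and \<open>T\<^sub>1\<^sub>1(v + 1)\<close> are invertible, \<open>Q(v)\<close> is \<open>T\<^sub>1\<^sub>1(v + 1) h\<^sub>2(v)\<close> with
  \<open>h\<^sub>2(v) = T\<^sub>2\<^sub>2(v) - T\<^sub>2\<^sub>1(v) T\<^sub>1\<^sub>1(v)\<^sup>-\<^sup>1 T\<^sub>1\<^sub>2(v)\<close> the second diagonal factor of the Gauss decomposition. The
  quotient \<open>h\<^sub>1(v)/h\<^sub>2(v)\<close>, where \<open>h\<^sub>1 = T\<^sub>1\<^sub>1\<close>, is the quantum Berezinian, which is central; hence \<open>Q(v)\<close>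
  is \<open>T\<^sub>1\<^sub>1(v + 1) T\<^sub>1\<^sub>1(v)\<close> up to a central factor.
\<close>
definition Q :: "complex \<Rightarrow> 'v \<Rightarrow> 'v" where
  "Q v x = T I1 I1 (v + 1) (T I2 I2 v x) - T I2 I1 (v + 1) (T I1 I2 v x)"

lemma Q_altdef: "Q v x = T I2 I2 (v + 1) (T I1 I1 v x) + T I1 I2 (v + 1) (T I2 I1 v x)"
proof (rule eq_by_linear_forms)
  fix \<phi> assume \<phi>: "linear_form \<phi>"
  show "\<phi> (Q v x) = \<phi> (T I2 I2 (v + 1) (T I1 I1 v x) + T I1 I2 (v + 1) (T I2 I1 v x))"
    using T12_T21[OF \<phi>, of "v + 1" v x] T11_T22[OF \<phi>, of "v + 1" v x]
    unfolding Q_def linear_formD[OF \<phi>] by Groebner_Basis.algebra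
qed

lemma T21_T21_succ: "T I2 I1 (v + 1) (T I2 I1 v x) = 0"
proof (rule eq_by_linear_forms)
  fix \<phi> assume \<phi>: "linear_form \<phi>"
  show "\<phi> (T I2 I1 (v + 1) (T I2 I1 v x)) = \<phi> 0"
    using T21_T21[OF \<phi>, of "v + 1" v x] by (simp add: linear_formD[OF \<phi>])
qed

lemma T11_T21_succ: "T I1 I1 (v + 1) (T I2 I1 v x) = T I2 I1 (v + 1) (T I1 I1 v x)"
proof (rule eq_by_linear_forms)
  fix \<phi> assume \<phi>: "linear_form \<phi>"
  show "\<phi> (T I1 I1 (v + 1) (T I2 I1 v x)) = \<phi> (T I2 I1 (v + 1) (T I1 I1 v x))"
    using T11_T21[OF \<phi>, of "v + 1" v x] by (simp add: linear_formD[OF \<phi>])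
qed

text \<open>
  The last term contains \<open>T\<^sub>1\<^sub>1(w)\<close> on the right, so it disappears on vectors killed by \<open>T\<^sub>1\<^sub>1(w)\<close>, and there
  \<open>T\<^sub>2\<^sub>1(w)\<close> commutes with \<open>Q(v)\<close> up to a scalar.
\<close>
lemma Q_T21:
  assumes "v \<noteq> w"
  shows "(v - w + 1) *s Q v (T I2 I1 w x)
    = (v - w - 1) *s T I2 I1 w (Q v x) + 2 *s T I2 I1 (v + 1) (T I2 I2 v (T I1 I1 w x))"
proof (rule eq_by_linear_forms)
  fix \<phi> assume \<phi>: "linear_form \<phi>"
  define a where "a = v - w"
  have a: "a \<noteq> 0" using assms by (simp add: a_def)
  note \<phi>T = linear_form_T[OF \<phi>]
  let ?\<psi> = "\<lambda>x. \<phi> (T I2 I1 (v + 1) x)"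
  define R where "R = \<phi> (T I1 I1 (v + 1) (T I2 I2 v (T I2 I1 w x)))"
  define Y where "Y = ?\<psi> (T I1 I2 v (T I2 I1 w x))"
  define A where "A = \<phi> (T I2 I1 w (T I1 I1 (v + 1) (T I2 I2 v x)))"
  define B where "B = \<phi> (T I2 I1 w (T I2 I1 (v + 1) (T I1 I2 v x)))"
  define B' where "B' = ?\<psi> (T I2 I1 w (T I1 I2 v x))"
  define C where "C = ?\<psi> (T I2 I2 v (T I1 I1 w x))"
  define D where "D = ?\<psi> (T I1 I1 w (T I2 I2 v x))"
  define E where "E = ?\<psi> (T I1 I1 v (T I2 I2 w x))"
  define F where "F = ?\<psi> (T I2 I2 w (T I1 I1 v x))"
  define G where "G = \<phi> (T I1 I1 (v + 1) (T I2 I1 w (T I2 I2 v x)))"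
  \<comment> \<open>Move \<open>T\<^sub>2\<^sub>1(w)\<close> to the left in both terms of \<open>Q(v) T\<^sub>2\<^sub>1(w)\<close>; what remains behind \<open>T\<^sub>2\<^sub>1(v + 1)\<close> is
    sorted with the relation of \<open>T\<^sub>1\<^sub>1\<close> and \<open>T\<^sub>2\<^sub>2\<close>, where \<open>T\<^sub>2\<^sub>1(v + 1) T\<^sub>2\<^sub>1(v) = 0\<close> removes one term.\<close>
  have 1: "a * R = (a - 1) * G + E"
    using T22_T21[OF \<phi>T, of v w I1 I1 "v + 1" x] T11_T21_succ[of v "T I2 I2 w x"]
    by (simp add: R_def G_def E_def a_def)
  have 2: "(a + 1) * G = a * A + D"
    using T11_T21[OF \<phi>, of "v + 1" w "T I2 I2 v x"]
    by (simp add: G_def A_def D_def a_def algebra_simps)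
  have 3: "a * (Y + B') = F - C"
    using T12_T21[OF \<phi>T, of v w I2 I1 "v + 1" x]
    by (simp add: Y_def B'_def F_def C_def a_def)
  have 4: "(a + 2) * B' = - a * B"
    using T21_T21[OF \<phi>, of "v + 1" w "T I1 I2 v x"]
    by (simp add: B_def B'_def a_def algebra_simps)
  have 5: "a * (E - F) = - B'"
    using T11_T22[OF \<phi>T, of v w I2 I1 "v + 1" x]
    by (simp add: E_def F_def B'_def a_def T21_T21_succ linear_formD[OF \<phi>])
  have 6: "- a * (D - C) = B'"
    using T11_T22[OF \<phi>T, of w v I2 I1 "v + 1" x]
    by (simp add: D_def C_def B'_def a_def T21_T21_succ linear_formD[OF \<phi>])
  have "a * a * ((a + 1) * (R - Y)) = a * a * ((a - 1) * (A - B) + 2 * C)"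
    using 1 2 3 4 5 6 by Groebner_Basis.algebra
  then have "(a + 1) * (R - Y) = (a - 1) * (A - B) + 2 * C"
    using a by simp
  then show "\<phi> ((v - w + 1) *s Q v (T I2 I1 w x)) =
    \<phi> ((v - w - 1) *s T I2 I1 w (Q v x) + 2 *s T I2 I1 (v + 1) (T I2 I2 v (T I1 I1 w x)))"
    by (simp add: linear_formD[OF \<phi>] linear_formD[OF \<phi>T] Q_def R_def Y_def A_def B_def C_def a_def)
qed

section \<open>Vectors depending polynomially on a parameter\<close>

text \<open>
  Relations such as the one for \<open>T\<^sub>1\<^sub>1\<close> and \<open>T\<^sub>2\<^sub>1\<close> determine a vector only where a factor \<open>u - w\<close> does not
  vanish. Polynomial dependence on the parameter extends the results to the excluded points.
\<close>
definition polynomial_family :: "(complex \<Rightarrow> 'v) \<Rightarrow> bool" where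
  "polynomial_family f \<longleftrightarrow> (\<forall>\<phi>. linear_form \<phi> \<longrightarrow> (\<exists>P. \<forall>u. \<phi> (f u) = poly P u))"

lemma polynomial_family_const: "polynomial_family (\<lambda>u. x)"
  unfolding polynomial_family_def by (meson poly_const_conv)

lemma polynomial_family_scale:
  assumes "polynomial_family f"
  shows "polynomial_family (\<lambda>u. poly c u *s f u)"
  unfolding polynomial_family_def
proof (intro allI impI)
  fix \<phi> assume \<phi>: "linear_form \<phi>"
  then obtain P where "\<And>u. \<phi> (f u) = poly P u"
    using assms unfolding polynomial_family_def by blast
  then have "\<forall>u. \<phi> (poly c u *s f u) = poly (c * P) u"
    by (simp add: linear_formD[OF \<phi>])
  then show "\<exists>P. \<forall>u. \<phi> (poly c u *s f u) = poly P u" by blast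
qed

lemma polynomial_family_add:
  assumes "polynomial_family f" "polynomial_family g"
  shows "polynomial_family (\<lambda>u. f u + g u)"
  unfolding polynomial_family_def
proof (intro allI impI)
  fix \<phi> assume \<phi>: "linear_form \<phi>"
  then obtain P P' where "\<And>u. \<phi> (f u) = poly P u" "\<And>u. \<phi> (g u) = poly P' u"
    using assms unfolding polynomial_family_def by metis
  then have "\<forall>u. \<phi> (f u + g u) = poly (P + P') u"
    by (simp add: linear_formD[OF \<phi>])
  then show "\<exists>P. \<forall>u. \<phi> (f u + g u) = poly P u" by blast
qed

lemma polynomial_family_uminus:
  "polynomial_family f \<Longrightarrow> polynomial_family (\<lambda>u. - f u)"
  using polynomial_family_scale[of f "-1"] by simp

lemma polynomial_family_diff:
  "polynomial_family f \<Longrightarrow> polynomial_family g \<Longrightarrow> polynomial_family (\<lambda>u. f u - g u)"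
  using polynomial_family_add[OF _ polynomial_family_uminus] by simp

lemma polynomial_family_sum:
  "(\<And>a. a \<in> A \<Longrightarrow> polynomial_family (f a)) \<Longrightarrow> polynomial_family (\<lambda>u. \<Sum>a\<in>A. f a u)"
  by (induction A rule: infinite_finite_induct)
    (auto intro: polynomial_family_const polynomial_family_add)

lemma polynomial_family_T:
  assumes f: "polynomial_family f" and g: "\<And>u. g u = poly c u"
  shows "polynomial_family (\<lambda>u. T i j (g u) (f u))"
proof -
  have t: "polynomial_family (\<lambda>u. t i j r (f u))" for r
    using f linear_form_t unfolding polynomial_family_def by blast
  show ?thesis
    unfolding T_def g poly_power[symmetric]
    by (intro polynomial_family_sum polynomial_family_scale t)
qed

lemma polynomial_family_lowering:
  "polynomial_family f \<Longrightarrow> polynomial_family (\<lambda>w. foldr (T I2 I1) us (f w))"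
  by (induction us) (auto intro!: polynomial_family_T[where c = "[:_:]"])

lemma polynomial_family_Q: "polynomial_family (\<lambda>v. Q v x)"
  unfolding Q_def
  by (intro polynomial_family_diff polynomial_family_T[where c = "[:1, 1:]"]
      polynomial_family_T[where c = "[:0, 1:]"] polynomial_family_const) simp_all

lemma polynomial_family_eqI:
  assumes f: "polynomial_family f" and g: "polynomial_family g"
    and S: "finite S" and eq: "\<And>u. u \<notin> S \<Longrightarrow> f u = g u"
  shows "f u = g u"
proof (rule eq_by_linear_forms)
  fix \<phi> assume \<phi>: "linear_form \<phi>"
  then obtain P P' where P: "\<And>u. \<phi> (f u) = poly P u" "\<And>u. \<phi> (g u) = poly P' u"
    using f g unfolding polynomial_family_def by metis
  have "- S \<subseteq> {u. poly (P - P') u = 0}"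
    using P eq by (metis (mono_tags, lifting) ComplD eq_iff_diff_eq_0 mem_Collect_eq poly_diff subsetI)
  moreover have "infinite (- S)"
    using S by (simp add: Compl_eq_Diff_UNIV infinite_UNIV_char_0)
  ultimately have "P - P' = 0"
    using poly_roots_finite finite_subset by blast
  then show "\<phi> (f u) = \<phi> (g u)" using P by simp
qed

lemma T_coeffs_of_values:
  assumes eq: "\<And>u. T i j u x = poly f u *s y" and deg: "degree f \<le> p" and k: "k \<le> p"
  shows "t i j (p - k) x = coeff f k *s y"
proof (rule eq_by_linear_forms)
  fix \<phi> assume \<phi>: "linear_form \<phi>"
  define P where "P = (\<Sum>k\<le>p. monom (\<phi> (t i j (p - k) x)) k)"
  have "poly P u = poly (smult (\<phi> y) f) u" for u
    using arg_cong[OF eq[of u], of \<phi>]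
    by (simp add: P_def poly_sum_monom form_T[OF \<phi>] linear_formD[OF \<phi>])
  then have "P = smult (\<phi> y) f"
    by (intro poly_eq_poly_eq_iff[THEN iffD1] ext)
  moreover have "coeff P k = \<phi> (t i j (p - k) x)"
    using k by (simp add: P_def coeff_sum if_distrib cong: if_cong)
  ultimately show "\<phi> (t i j (p - k) x) = \<phi> (coeff f k *s y)"
    by (simp add: linear_formD[OF \<phi>] mult.commute)
qed

lemma T_values_of_coeffs:
  assumes "\<And>k. k \<le> p \<Longrightarrow> t i j (p - k) x = coeff f k *s y" "degree f \<le> p"
  shows "T i j u x = poly f u *s y"
proof -
  have "T i j u x = (\<Sum>k\<le>p. coeff f k * u ^ k) *s y"
    using assms(1) by (simp add: T_def scale_sum_left mult.commute)
  also have "(\<Sum>k\<le>p. coeff f k * u ^ k) = poly f u"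
    unfolding poly_altdef using assms(2)
    by (intro sum.mono_neutral_right) (auto simp: coeff_eq_0)
  finally show ?thesis .
qed

text \<open>
  The coefficient of \<open>u\<^sup>p\<close> in \<open>T\<^sub>2\<^sub>1(u)\<close> is the off-diagonal constant term 0, so \<open>T\<^sub>2\<^sub>1(u) x\<close> has degree
  less than \<open>p\<close> and \<open>p\<close> zeros suffice.
\<close>
lemma T21_eq_0_if_many_zeros:
  assumes S: "finite S" "p \<le> card S" and zero: "\<And>u. u \<in> S \<Longrightarrow> T I2 I1 u x = 0"
  shows "T I2 I1 u x = 0"
proof (rule eq_by_linear_forms)
  fix \<phi> assume \<phi>: "linear_form \<phi>"
  define P where "P = (\<Sum>k\<le>p. monom (\<phi> (t I2 I1 (p - k) x)) k)"
  have P: "poly P u = \<phi> (T I2 I1 u x)" for u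
    by (simp add: P_def poly_sum_monom form_T[OF \<phi>])
  have "P = 0"
  proof (rule ccontr)
    assume nz: "P \<noteq> 0"
    have "coeff P p = 0"
      by (simp add: P_def coeff_sum if_distrib t_0 linear_formD[OF \<phi>] cong: if_cong)
    then have "degree P \<noteq> p" using nz by auto
    moreover have "degree P \<le> p"
      unfolding P_def by (intro degree_sum_le) (auto intro: degree_monom_le order_trans)
    moreover have "card S \<le> card {u. poly P u = 0}"
      using zero nz by (intro card_mono poly_roots_finite) (auto simp: P linear_formD[OF \<phi>])
    ultimately show False
      using S(2) card_poly_roots_bound[OF nz] by linarith
  qed
  then show "\<phi> (T I2 I1 u x) = \<phi> 0" using P[of u] by (simp add: linear_formD[OF \<phi>])
qed

sublocale T: module_hom scale scale "T i j u" for i j u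
  using linear_T module_hom_iff_linear by blast

text \<open>
  \<open>T\<^sub>2\<^sub>1(v + 1)\<close> is moved to the right, up to nonzero scalars, until it meets \<open>T\<^sub>2\<^sub>1(v)\<close>. Passing \<open>T\<^sub>2\<^sub>1(a)\<close>
  requires \<open>(v + 1) - a + 1 \<noteq> 0\<close>, which is where the 2 comes from.
\<close>
lemma T21_annihilates_lowering:
  assumes "v \<in> set vs" "sorted_wrt (\<lambda>a b. a - b \<noteq> 2) vs"
  shows "T I2 I1 (v + 1) (foldr (T I2 I1) vs x) = 0"
  using assms
proof (induction vs)
  case (Cons a vs)
  show ?case
  proof (cases "v = a")
    case True
    then show ?thesis by (simp add: T21_T21_succ)
  next
    case False
    then have v: "v \<in> set vs" using Cons.prems by simp
    let ?y = "foldr (T I2 I1) vs x"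
    have IH: "T I2 I1 (v + 1) ?y = 0" using Cons v by simp
    have nz: "v + 1 - a + 1 \<noteq> 0" using Cons.prems(2) v by (auto simp: algebra_simps)
    show ?thesis
    proof (rule eq_by_linear_forms)
      fix \<phi> assume \<phi>: "linear_form \<phi>"
      show "\<phi> (T I2 I1 (v + 1) (foldr (T I2 I1) (a # vs) x)) = \<phi> 0"
        using T21_T21[OF \<phi>, of "v + 1" a ?y] nz by (simp add: IH T.zero linear_formD[OF \<phi>])
    qed
  qed
qed simp

text \<open>
  Products of \<open>p + 1\<close> operators \<open>T\<^sub>2\<^sub>1\<close> vanish. The points \<open>vs\<close> are in general position, the points
  \<open>us\<close> are arbitrary. Without \<open>us\<close>, there are \<open>p\<close> distinct zeros \<open>v + 1\<close>. An arbitrary point is added as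
  the last of \<open>us\<close>: for all but finitely many values it could as well be the first of \<open>vs\<close>.
\<close>
lemma T21_lowering_eq_0:
  assumes "distinct vs" "sorted_wrt (\<lambda>a b. a - b \<noteq> 2) vs" "length us + length vs = p"
  shows "T I2 I1 u (foldr (T I2 I1) (us @ vs) x) = 0"
  using assms
proof (induction us arbitrary: vs rule: rev_induct)
  case Nil
  show ?case
  proof (rule T21_eq_0_if_many_zeros)
    show "p \<le> card ((\<lambda>v. v + 1) ` set vs)"
      using Nil by (subst card_image) (auto simp: distinct_card)
    show "T I2 I1 v (foldr (T I2 I1) ([] @ vs) x) = 0" if "v \<in> (\<lambda>v. v + 1) ` set vs" for v
      using that T21_annihilates_lowering[OF _ Nil(2)] by auto
  qed simp
next
  case (snoc w us)
  let ?f = "\<lambda>w. T I2 I1 u (foldr (T I2 I1) us (T I2 I1 w (foldr (T I2 I1) vs x)))"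
  have "?f w = 0"
  proof (rule polynomial_family_eqI[of ?f "\<lambda>_. 0"])
    show "polynomial_family ?f"
      by (intro polynomial_family_T[where g = "\<lambda>_. u" and c = "[:u:]"] polynomial_family_lowering
          polynomial_family_T[where c = "[:0, 1:]"] polynomial_family_const) simp_all
    show "finite (set vs \<union> (\<lambda>b. b + 2) ` set vs)" by simp
    show "?f w = 0" if "w \<notin> set vs \<union> (\<lambda>b. b + 2) ` set vs" for w
      using that snoc.IH[of "w # vs"] snoc.prems by (auto simp: algebra_simps)
  qed (rule polynomial_family_const)
  then show ?case by simp
qed

section \<open>Lowering a common eigenvector\<close>

text \<open>
  The eigenvalue vanishes at \<open>w\<close>, which kills the term \<open>T\<^sub>2\<^sub>1(u) T\<^sub>1\<^sub>1(w)\<close> of the commutation relation.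
  The factor \<open>u - w\<close> can be cancelled for \<open>u \<noteq> w\<close> only; polynomial continuation covers \<open>u = w\<close>, so that
  several of the roots used for lowering may coincide.
\<close>
lemma T11_lowered:
  assumes eig: "\<And>u. T I1 I1 u x = ((u - w) * poly m u) *s x"
  shows "T I1 I1 u (T I2 I1 w x) = ((u - w - 1) * poly m u) *s T I2 I1 w x"
proof -
  have "T I1 I1 u (T I2 I1 w x) = poly ([:- w - 1, 1:] * m) u *s T I2 I1 w x"
  proof (rule polynomial_family_eqI[where S = "{w}"
        and f = "\<lambda>u. T I1 I1 u (T I2 I1 w x)"
        and g = "\<lambda>u. poly ([:- w - 1, 1:] * m) u *s T I2 I1 w x"])
    show "polynomial_family (\<lambda>u. T I1 I1 u (T I2 I1 w x))"
      by (intro polynomial_family_T[where c = "[:0, 1:]"] polynomial_family_const) simp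
    show "polynomial_family (\<lambda>u. poly ([:- w - 1, 1:] * m) u *s T I2 I1 w x)"
      by (intro polynomial_family_scale polynomial_family_const)
    show "T I1 I1 u (T I2 I1 w x) = poly ([:- w - 1, 1:] * m) u *s T I2 I1 w x"
      if "u \<notin> {w}" for u
    proof (rule eq_by_linear_forms)
      fix \<phi> assume \<phi>: "linear_form \<phi>"
      have "(u - w) * \<phi> (T I1 I1 u (T I2 I1 w x)) = (u - w) * ((u - w - 1) * poly m u * \<phi> (T I2 I1 w x))"
        using T11_T21[OF \<phi>, of u w x] by (simp add: eig T.scale T.zero linear_formD[OF \<phi>] mult.assoc)
      then have "\<phi> (T I1 I1 u (T I2 I1 w x)) = (u - w - 1) * poly m u * \<phi> (T I2 I1 w x)"
        using that by simp
      then show "\<phi> (T I1 I1 u (T I2 I1 w x)) = \<phi> (poly ([:- w - 1, 1:] * m) u *s T I2 I1 w x)"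
        by (simp add: linear_formD[OF \<phi>] algebra_simps)
    qed
  qed simp
  then show ?thesis by (simp add: algebra_simps)
qed

lemma Q_lowered:
  assumes T11: "T I1 I1 w x = 0"
    and eig: "\<And>v. Q v x = ((v - w + 1) * poly q v) *s x"
  shows "Q v (T I2 I1 w x) = ((v - w - 1) * poly q v) *s T I2 I1 w x"
proof -
  have "Q v (T I2 I1 w x) = poly ([:- w - 1, 1:] * q) v *s T I2 I1 w x"
  \<comment> \<open>\<open>v = w\<close> is excluded by \<open>Q_T21\<close>, and at \<open>v = w - 1\<close> the factor in front of \<open>Q\<close> there is zero.\<close>
  proof (rule polynomial_family_eqI[where S = "{w, w - 1}"
        and f = "\<lambda>v. Q v (T I2 I1 w x)"
        and g = "\<lambda>v. poly ([:- w - 1, 1:] * q) v *s T I2 I1 w x"])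
    show "polynomial_family (\<lambda>u. poly ([:- w - 1, 1:] * q) u *s T I2 I1 w x)"
      by (intro polynomial_family_scale polynomial_family_const)
    show "Q v (T I2 I1 w x) = poly ([:- w - 1, 1:] * q) v *s T I2 I1 w x"
      if v: "v \<notin> {w, w - 1}" for v
    proof -
      have nz: "v - w + 1 \<noteq> 0" using v by (auto simp: algebra_simps)
      have "(v - w + 1) *s Q v (T I2 I1 w x)
          = (v - w + 1) *s (((v - w - 1) * poly q v) *s T I2 I1 w x)"
        using Q_T21[of v w x] v by (simp add: T11 eig T.scale T.zero mult_ac)
      then have "Q v (T I2 I1 w x) = ((v - w - 1) * poly q v) *s T I2 I1 w x"
        using nz by (metis scale_left_imp_eq)
      then show ?thesis by (simp add: algebra_simps)
    qed
  qed (simp_all add: polynomial_family_Q)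
  then show ?thesis by (simp add: algebra_simps)
qed

end

text \<open>
  For \<open>c = 0\<close> and the list of all \<open>\<alpha>\<^sub>i\<close> this is the highest weight \<open>\<lambda>\<^sub>1\<close>; each lowering step replaces
  one factor \<open>u + \<alpha>\<^sub>i\<close> of the eigenvalue of \<open>T\<^sub>1\<^sub>1\<close> by \<open>u + \<alpha>\<^sub>i - 1\<close>.
\<close>
definition shifted_roots_poly :: "complex \<Rightarrow> complex list \<Rightarrow> complex poly" where
  "shifted_roots_poly c as = (\<Prod>a\<leftarrow>as. [:a + c, 1:])"

lemma poly_shifted_roots_poly: "poly (shifted_roots_poly c as) u = (\<Prod>a\<leftarrow>as. u + a + c)"
  by (induction as) (simp_all add: shifted_roots_poly_def algebra_simps)

locale highest_weight_vector = yangian_rep +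
  fixes as :: "complex list" and b :: "complex poly" and \<xi>
  assumes T11_\<xi>: "T I1 I1 u \<xi> = poly (shifted_roots_poly 0 as) u *s \<xi>"
    and T22_\<xi>: "T I2 I2 u \<xi> = poly b u *s \<xi>"
    and T12_\<xi>: "T I1 I2 u \<xi> = 0"
begin

definition \<eta> :: "complex list \<Rightarrow> 'a" where
  "\<eta> cs = foldr (T I2 I1) (map uminus cs) \<xi>"

lemma \<eta>_Nil: "\<eta> [] = \<xi>" and \<eta>_Cons: "\<eta> (c # cs) = T I2 I1 (- c) (\<eta> cs)"
  by (simp_all add: \<eta>_def)

text \<open>
  In the next two lemmas \<open>rest\<close> are the roots that have not been used for lowering yet.
\<close>
lemma T11_\<eta>:
  assumes "as = rest @ cs"
  shows "T I1 I1 u (\<eta> cs)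
    = (poly (shifted_roots_poly 0 rest) u * poly (shifted_roots_poly (- 1) cs) u) *s \<eta> cs"
  using assms
proof (induction cs arbitrary: rest u)
  case Nil
  then show ?case by (simp add: \<eta>_Nil T11_\<xi> shifted_roots_poly_def)
next
  case (Cons c cs)
  have "T I1 I1 u (\<eta> cs) = ((u - (- c))
      * poly (shifted_roots_poly 0 rest * shifted_roots_poly (- 1) cs) u) *s \<eta> cs" for u
    using Cons.IH[of "rest @ [c]" u] Cons.prems by (simp add: poly_shifted_roots_poly mult_ac)
  from T11_lowered[OF this, of u] show ?case
    by (simp add: \<eta>_Cons poly_shifted_roots_poly mult_ac)
qed

text \<open>
  \<open>Q(v) \<xi> = \<lambda>\<^sub>1(v + 1) \<lambda>\<^sub>2(v) \<xi>\<close>, and lowering at \<open>-c\<close> replaces the factor \<open>v + c + 1\<close> by \<open>v + c - 1\<close>.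
\<close>
lemma Q_\<eta>:
  assumes "as = rest @ cs"
  shows "Q v (\<eta> cs)
    = (poly b v * poly (shifted_roots_poly 1 rest) v * poly (shifted_roots_poly (- 1) cs) v) *s \<eta> cs"
  using assms
proof (induction cs arbitrary: rest v)
  case Nil
  then show ?case
    by (simp add: \<eta>_Nil Q_def T11_\<xi> T22_\<xi> T12_\<xi> T.scale T.zero poly_shifted_roots_poly add_ac)
next
  case (Cons c cs)
  have as: "as = (rest @ [c]) @ cs" using Cons.prems by simp
  have "Q v (\<eta> cs) = ((v - (- c) + 1)
      * poly (b * shifted_roots_poly 1 rest * shifted_roots_poly (- 1) cs) v) *s \<eta> cs" for v
    using Cons.IH[OF as, of v] by (simp add: poly_shifted_roots_poly mult_ac)
  note eig = this
  have "T I1 I1 (- c) (\<eta> cs) = 0"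
    using T11_\<eta>[OF as, of "- c"] by (simp add: poly_shifted_roots_poly)
  from Q_lowered[OF this eig, of v] show ?case
    by (simp add: \<eta>_Cons poly_shifted_roots_poly mult_ac)
qed

text \<open>
  Each lowering step can be undone: \<open>T\<^sub>1\<^sub>1(-c)\<close> kills \<open>\<eta> cs\<close>, so the second form of \<open>Q\<close> gives
  \<open>T\<^sub>1\<^sub>2(-c + 1) T\<^sub>2\<^sub>1(-c) \<eta> = Q(-c) \<eta>\<close>, and the hypotheses on the roots say that this eigenvalue of
  \<open>Q\<close> is nonzero.
\<close>
lemma \<eta>_nonzero:
  assumes "as = rest @ cs" "\<xi> \<noteq> 0"
    and "sorted_wrt (\<lambda>x y. x - y + 1 \<noteq> 0) as" "\<And>a. a \<in> set as \<Longrightarrow> poly b (- a) \<noteq> 0"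
  shows "\<eta> cs \<noteq> 0"
  using assms(1)
proof (induction cs arbitrary: rest)
  case Nil
  then show ?case using assms(2) by (simp add: \<eta>_Nil)
next
  case (Cons c cs)
  have as: "as = (rest @ [c]) @ cs" using Cons.prems by simp
  have "T I1 I1 (- c) (\<eta> cs) = 0"
    using T11_\<eta>[OF as, of "- c"] by (simp add: poly_shifted_roots_poly)
  then have "T I1 I2 (- c + 1) (\<eta> (c # cs)) = Q (- c) (\<eta> cs)"
    by (simp add: Q_altdef \<eta>_Cons T.zero)
  also have "\<dots> = (poly b (- c) * poly (shifted_roots_poly 1 (rest @ [c])) (- c)
        * poly (shifted_roots_poly (- 1) cs) (- c)) *s \<eta> cs"
    by (rule Q_\<eta>[OF as])
  also have "\<dots> \<noteq> 0"
  proof -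
    have "poly (shifted_roots_poly 1 (rest @ [c])) (- c) \<noteq> 0"
      using assms(3) Cons.prems
      by (auto simp: poly_shifted_roots_poly prod_list_zero_iff sorted_wrt_append algebra_simps)
    moreover have "poly (shifted_roots_poly (- 1) cs) (- c) \<noteq> 0"
      using assms(3) Cons.prems
      by (auto simp: poly_shifted_roots_poly prod_list_zero_iff sorted_wrt_append algebra_simps)
    moreover have "poly b (- c) \<noteq> 0"
      using assms(4) Cons.prems by simp
    ultimately show ?thesis
      using Cons.IH[OF as] by simp
  qed
  finally show ?case by (metis T.zero)
qed

lemma T21_full_\<eta>:
  assumes "length as = p"
  shows "T I2 I1 u (\<eta> as) = 0"
  using T21_lowering_eq_0[of "[]" "map uminus as" u \<xi>] assms by (simp add: \<eta>_def)

lemma T11_full_\<eta>: "T I1 I1 u (\<eta> as) = poly (shifted_roots_poly (- 1) as) u *s \<eta> as"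
  using T11_\<eta>[of "[]" as u] by (simp add: poly_shifted_roots_poly)

text \<open>
  As \<open>T\<^sub>2\<^sub>1\<close> kills the fully lowered vector, the second form of \<open>Q\<close> reduces to
  \<open>T\<^sub>2\<^sub>2(v + 1) T\<^sub>1\<^sub>1(v)\<close>. The eigenvalue of \<open>T\<^sub>1\<^sub>1(v)\<close> cancels away from its zeros.
\<close>
lemma T22_full_\<eta>:
  assumes "length as = p"
  shows "T I2 I2 u (\<eta> as) = poly b (u - 1) *s \<eta> as"
proof -
  let ?A = "shifted_roots_poly (- 1) as"
  have "T I2 I2 (v + 1) (\<eta> as) = poly b v *s \<eta> as" for v
  proof (rule polynomial_family_eqI[where S = "{v. poly ?A v = 0}"
        and f = "\<lambda>v. T I2 I2 (v + 1) (\<eta> as)" and g = "\<lambda>v. poly b v *s \<eta> as"])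
    have "?A \<noteq> 0" by (auto simp: shifted_roots_poly_def prod_list_zero_iff)
    then show "finite {v. poly ?A v = 0}" by (rule poly_roots_finite)
    show "polynomial_family (\<lambda>v. T I2 I2 (v + 1) (\<eta> as))"
      by (intro polynomial_family_T[where c = "[:1, 1:]"] polynomial_family_const) simp
    show "polynomial_family (\<lambda>v. poly b v *s \<eta> as)"
      by (intro polynomial_family_scale polynomial_family_const)
    show "T I2 I2 (v + 1) (\<eta> as) = poly b v *s \<eta> as" if "v \<notin> {v. poly ?A v = 0}" for v
    proof -
      have "poly ?A v *s T I2 I2 (v + 1) (\<eta> as) = Q v (\<eta> as)"
        by (simp add: Q_altdef T11_full_\<eta> T21_full_\<eta>[OF assms] T.scale T.zero)
      also have "\<dots> = poly ?A v *s (poly b v *s \<eta> as)"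
        using Q_\<eta>[of "[]" as v] by (simp add: poly_shifted_roots_poly mult_ac)
      finally show ?thesis using that by (metis (mono_tags, lifting) mem_Collect_eq scale_left_imp_eq)
    qed
  qed
  from this[of "u - 1"] show ?thesis by simp
qed

end

section \<open>Left modules and their quotients\<close>

locale left_module = R?: ring R + M?: abelian_group M
  for R :: "('a, 'm) ring_scheme" and M :: "('a, 'b) module" (structure) +
  assumes smult_closed: "\<lbrakk>a \<in> carrier R; x \<in> carrier M\<rbrakk> \<Longrightarrow> a \<odot> x \<in> carrier M"
    and smult_l_distr: "\<lbrakk>a \<in> carrier R; b \<in> carrier R; x \<in> carrier M\<rbrakk>
      \<Longrightarrow> (a \<oplus>\<^bsub>R\<^esub> b) \<odot> x = a \<odot> x \<oplus> b \<odot> x"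
    and smult_r_distr: "\<lbrakk>a \<in> carrier R; x \<in> carrier M; y \<in> carrier M\<rbrakk>
      \<Longrightarrow> a \<odot> (x \<oplus> y) = a \<odot> x \<oplus> a \<odot> y"
    and smult_assoc: "\<lbrakk>a \<in> carrier R; b \<in> carrier R; x \<in> carrier M\<rbrakk>
      \<Longrightarrow> (a \<otimes>\<^bsub>R\<^esub> b) \<odot> x = a \<odot> (b \<odot> x)"
    and smult_one: "x \<in> carrier M \<Longrightarrow> \<one>\<^bsub>R\<^esub> \<odot> x = x"
begin

lemma smult_zero_left:
  assumes x: "x \<in> carrier M" shows "\<zero>\<^bsub>R\<^esub> \<odot> x = \<zero>"
proof -
  have z: "\<zero>\<^bsub>R\<^esub> \<odot> x \<in> carrier M" using x by (simp add: smult_closed)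
  have "\<zero>\<^bsub>R\<^esub> \<odot> x \<oplus> \<zero>\<^bsub>R\<^esub> \<odot> x = \<zero>\<^bsub>R\<^esub> \<odot> x"
    using smult_l_distr[of "\<zero>\<^bsub>R\<^esub>" "\<zero>\<^bsub>R\<^esub>" x] x by simp
  then show ?thesis using z by (metis M.add.r_cancel_one)
qed

lemma smult_zero_right:
  assumes a: "a \<in> carrier R" shows "a \<odot> \<zero> = \<zero>"
proof -
  have z: "a \<odot> \<zero> \<in> carrier M" using a by (simp add: smult_closed)
  have "a \<odot> \<zero> \<oplus> a \<odot> \<zero> = a \<odot> \<zero>"
    using smult_r_distr[of a \<zero> \<zero>] a by simp
  then show ?thesis using z by (metis M.add.r_cancel_one)
qed

lemma smult_eq_if_minus_kills:
  assumes "a \<in> carrier R" "b \<in> carrier R" "x \<in> carrier M" "(a \<ominus>\<^bsub>R\<^esub> b) \<odot> x = \<zero>"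
  shows "a \<odot> x = b \<odot> x"
proof -
  have "a \<odot> x = ((a \<ominus>\<^bsub>R\<^esub> b) \<oplus>\<^bsub>R\<^esub> b) \<odot> x"
    using assms(1-2) by (simp add: R.minus_eq R.add.m_assoc R.l_neg)
  also have "\<dots> = b \<odot> x"
    using assms by (simp add: smult_l_distr smult_closed)
  finally show ?thesis .
qed

lemma submodule_abelian_subgroup: "submodule N R M \<Longrightarrow> abelian_subgroup N M"
  by (intro abelian_subgroupI3 additive_subgroupI submodule.axioms(1) M.abelian_group_axioms)

text \<open>
  The action on a coset is a union over all its representatives; it collapses to one coset since
  \<open>N\<close> is stable under the ring.
\<close>
lemma smult_quot_module:
  assumes N: "submodule N R M" and a: "a \<in> carrier R" and x: "x \<in> carrier M"
  shows "a \<odot>\<^bsub>quot_module M N\<^esub> (N +> x) = N +> (a \<odot> x)"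
proof -
  interpret N: abelian_subgroup N M by (rule submodule_abelian_subgroup[OF N])
  have "N +> (a \<odot> y) = N +> (a \<odot> x)" if y: "y \<in> N +> x" for y
  proof -
    obtain n where n: "n \<in> N" "y = n \<oplus> x"
      using y by (auto simp: a_r_coset_def r_coset_def)
    have nM: "n \<in> carrier M" using n(1) N.a_subset by blast
    then have "a \<odot> y = a \<odot> n \<oplus> a \<odot> x"
      using n(2) a x by (simp add: smult_r_distr)
    moreover have "a \<odot> n \<in> N" by (rule submodule.smult_closed[OF N a n(1)])
    ultimately have "a \<odot> y \<in> N +> (a \<odot> x)"
      by (auto simp: a_r_coset_def r_coset_def)
    then show ?thesis
      using N.a_repr_independence' a x by (simp add: smult_closed)
  qed
  then have "(\<Union>y\<in>N +> x. N +> (a \<odot> y)) = (\<Union>y\<in>N +> x. N +> (a \<odot> x))"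
    by (intro SUP_cong refl)
  also have "\<dots> = N +> (a \<odot> x)"
    using N.a_rcos_self[OF x] by blast
  finally show ?thesis by (simp add: quot_module_def)
qed

lemma left_module_quot_module:
  assumes N: "submodule N R M"
  shows "left_module R (quot_module M N)"
proof -
  interpret N: abelian_subgroup N M by (rule submodule_abelian_subgroup[OF N])
  have car: "carrier (quot_module M N) = a_rcosets N"
    by (simp add: quot_module_def)
  have add: "(N +> x) \<oplus>\<^bsub>quot_module M N\<^esub> (N +> y) = N +> (x \<oplus> y)"
    if "x \<in> carrier M" "y \<in> carrier M" for x y
    using N.a_rcos_sum[OF that] by (simp add: quot_module_def)
  have coset: "\<exists>x\<in>carrier M. A = N +> x" if "A \<in> carrier (quot_module M N)" for A
    using that by (auto simp: car A_RCOSETS_def')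
  have in_car: "N +> x \<in> carrier (quot_module M N)" if "x \<in> carrier M" for x
    using that by (auto simp: car A_RCOSETS_def')
  have zero: "\<zero>\<^bsub>quot_module M N\<^esub> = N +> \<zero>"
    using N.a_subset by (simp add: quot_module_def)
  note smult_quot_module[OF N, simp] add[simp]
  have "abelian_group (quot_module M N)"
  proof (rule abelian_groupI)
    fix A assume "A \<in> carrier (quot_module M N)"
    then obtain x where x: "x \<in> carrier M" "A = N +> x" using coset by blast
    then have "(N +> (\<ominus> x)) \<oplus>\<^bsub>quot_module M N\<^esub> A = \<zero>\<^bsub>quot_module M N\<^esub>"
      by (simp add: zero M.l_neg)
    then show "\<exists>B\<in>carrier (quot_module M N). B \<oplus>\<^bsub>quot_module M N\<^esub> A = \<zero>\<^bsub>quot_module M N\<^esub>"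
      using x in_car by blast
    show "A \<oplus>\<^bsub>quot_module M N\<^esub> B = B \<oplus>\<^bsub>quot_module M N\<^esub> A"
      if "B \<in> carrier (quot_module M N)" for B
      using x coset[OF that] by (auto simp: M.a_comm)
  qed (auto dest!: coset simp: zero M.a_assoc intro!: in_car)
  then show ?thesis
    by (intro left_module.intro left_module_axioms.intro R.ring_axioms)
      (auto dest!: coset simp: smult_closed smult_l_distr smult_r_distr smult_assoc smult_one
        intro!: in_car)
qed

end

context ring
begin

lemma left_module_regular_module: "left_module R (regular_module R)"
proof -
  have "abelian_group (regular_module R)"
  proof (rule abelian_groupI)
    fix x assume "x \<in> carrier (regular_module R)"
    then show "\<exists>y\<in>carrier (regular_module R).
        y \<oplus>\<^bsub>regular_module R\<^esub> x = \<zero>\<^bsub>regular_module R\<^esub>"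
      by (intro bexI[of _ "\<ominus> x"]) (simp_all add: regular_module_def l_neg)
    show "x \<oplus>\<^bsub>regular_module R\<^esub> y = y \<oplus>\<^bsub>regular_module R\<^esub> x"
      if "y \<in> carrier (regular_module R)" for y
      using \<open>x \<in> _\<close> that a_comm by (simp add: regular_module_def)
  qed (simp_all add: regular_module_def a_assoc)
  then show ?thesis
    by (intro left_module.intro left_module_axioms.intro ring_axioms)
      (simp_all add: regular_module_def l_distr r_distr m_assoc)
qed

lemma submodule_left_ideal_gen:
  assumes S: "S \<subseteq> carrier R"
  shows "submodule (left_ideal_gen R S) R (regular_module R)"
proof -
  let ?M = "regular_module R"
  let ?C = "{J. submodule J R ?M \<and> S \<subseteq> J}"
  interpret M: left_module R ?M by (rule left_module_regular_module)
  have "submodule (carrier R) R ?M"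
    using M.add.subgroup_self
    by (intro submodule.intro submodule_axioms.intro) (simp_all add: regular_module_def)
  then have "carrier R \<in> ?C" using S by simp
  then have "?C \<noteq> {}" by blast
  moreover have sub: "subgroup J (add_monoid ?M)" "\<And>a x. a \<in> carrier R \<Longrightarrow> x \<in> J \<Longrightarrow> a \<odot>\<^bsub>?M\<^esub> x \<in> J"
    if "J \<in> ?C" for J
    using that by (auto simp: submodule_def submodule_axioms_def)
  ultimately have "subgroup (\<Inter>?C) (add_monoid ?M)"
    by (intro M.add.subgroups_Inter) auto
  with sub(2) show ?thesis
    unfolding left_ideal_gen_def by (intro submodule.intro submodule_axioms.intro) blast+
qed

lemma left_ideal_gen_superset: "S \<subseteq> left_ideal_gen R S"
  by (auto simp: left_ideal_gen_def)

end

section \<open>Ring structure of the Yangian of level p\<close>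

lemma free_ring_simps [simp]:
  "carrier free_ring = UNIV" "x \<otimes>\<^bsub>free_ring\<^esub> y = x * y" "\<one>\<^bsub>free_ring\<^esub> = 1"
  "x \<oplus>\<^bsub>free_ring\<^esub> y = x + y" "\<zero>\<^bsub>free_ring\<^esub> = 0"
  by (simp_all add: ring_of_type_algebra_def)

lemma ring_free_ring: "ring free_ring"
proof -
  have "\<exists>y. x + y = 0" for x :: "gen free_alg"
    using add.right_inverse by blast
  then show ?thesis
    unfolding ring_of_type_algebra_def using add.right_inverse
    by unfold_locales (auto simp: algebra_simps Units_def)
qed

lemma ideal_yangian_ideal: "ideal yangian_ideal free_ring"
  unfolding yangian_ideal_def by (rule ring.genideal_ideal[OF ring_free_ring]) simp

lemma ring_yangian: "ring yangian"
  unfolding yangian_def by (rule ideal.quotient_is_ring[OF ideal_yangian_ideal])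

lemma yangian_proj_hom: "yangian_proj \<in> ring_hom free_ring yangian"
  using ideal.rcos_ring_hom[OF ideal_yangian_ideal]
  unfolding yangian_def yangian_proj_def[abs_def] .

lemma yangian_proj_closed: "yangian_proj x \<in> carrier yangian"
  using ring_hom_closed[OF yangian_proj_hom] by simp

lemma ideal_level_ideal: "ideal (level_ideal p) yangian"
  unfolding level_ideal_def
  by (rule ring.genideal_ideal[OF ring_yangian]) (auto simp: yangian_proj_closed)

lemma ring_Yp: "ring (Yp p)"
  unfolding Yp_def by (rule ideal.quotient_is_ring[OF ideal_level_ideal])

lemma Yp_proj_hom: "Yp_proj p \<in> ring_hom free_ring (Yp p)"
  using ring_hom_trans[OF yangian_proj_hom ideal.rcos_ring_hom[OF ideal_level_ideal]]
  unfolding Yp_def Yp_proj_def[abs_def] o_def .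

lemma Yp_proj_simps:
  "Yp_proj p x \<in> carrier (Yp p)"
  "Yp_proj p (x + y) = Yp_proj p x \<oplus>\<^bsub>Yp p\<^esub> Yp_proj p y"
  "Yp_proj p (x * y) = Yp_proj p x \<otimes>\<^bsub>Yp p\<^esub> Yp_proj p y"
  "Yp_proj p 1 = \<one>\<^bsub>Yp p\<^esub>"
  "Yp_proj p 0 = \<zero>\<^bsub>Yp p\<^esub>"
  using ring_hom_closed[OF Yp_proj_hom] ring_hom_add[OF Yp_proj_hom] ring_hom_mult[OF Yp_proj_hom]
    ring_hom_one[OF Yp_proj_hom] ring_hom_zero[OF Yp_proj_hom ring_free_ring ring_Yp]
  by simp_all

lemma Yp_proj_eq_zeroI: "yangian_proj x \<in> level_ideal p \<Longrightarrow> Yp_proj p x = \<zero>\<^bsub>Yp p\<^esub>"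
  using abelian_subgroup.a_rcos_const[of "level_ideal p" yangian]
    ideal_level_ideal[of p] unfolding Yp_proj_def Yp_def FactRing_def
  by (simp add: ideal.axioms(1) abelian_subgroupI3 ring.is_abelian_group ring_yangian)

lemma Yp_proj_relator: "Yp_proj p (yangian_relator i j k l r s) = \<zero>\<^bsub>Yp p\<^esub>"
proof (rule Yp_proj_eq_zeroI)
  have "yangian_relator i j k l r s \<in> yangian_ideal"
    unfolding yangian_ideal_def
    by (rule subsetD[OF ring.genideal_self[OF ring_free_ring]]) (simp, blast)
  then have "yangian_proj (yangian_relator i j k l r s) = \<zero>\<^bsub>yangian\<^esub>"
    using abelian_subgroup.a_rcos_const[of yangian_ideal free_ring] ideal_yangian_ideal
    unfolding yangian_proj_def yangian_def FactRing_def
    by (simp add: ideal.axioms(1) abelian_subgroupI3 ring.is_abelian_group ring_free_ring)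
  then show "yangian_proj (yangian_relator i j k l r s) \<in> level_ideal p"
    using additive_subgroup.zero_closed[OF ideal.axioms(1)[OF ideal_level_ideal]] by simp
qed

lemma Yp_proj_above_level: "r > p \<Longrightarrow> Yp_proj p (t_free i j r) = \<zero>\<^bsub>Yp p\<^esub>"
  unfolding level_ideal_def
  by (intro Yp_proj_eq_zeroI, unfold level_ideal_def, rule subsetD[OF ring.genideal_self[OF ring_yangian]])
    (auto simp: yangian_proj_closed)

lemma T_coeff_closed: "T_coeff p i j k \<in> carrier (Yp p)"
  using ring.ring_simprules(2)[OF ring_Yp] by (simp add: T_coeff_def Yp_proj_simps)

lemma Yp_scalar_closed: "Yp_scalar p c \<in> carrier (Yp p)"
  by (simp add: Yp_scalar_def Yp_proj_simps)

section \<open>Irreducible quotients of Verma modules\<close>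

locale Yp_module = left_module "Yp p" L for p and L :: "(yp, 'v) module" (structure) +
  fixes \<xi>
  assumes \<xi>_closed: "\<xi> \<in> carrier L"

text \<open>
  \<open>\<xi>\<close> is nonzero because every element of \<open>L\<close> is of the form \<open>a \<xi>\<close> and \<open>L\<close> is not the zero module.
\<close>
lemma irreducible_quotient_of_vermaD:
  assumes "irreducible_quotient_of_verma p lam1 lam2 L \<xi>"
  shows "Yp_module p L \<xi>" and "\<xi> \<noteq> \<zero>\<^bsub>L\<^esub>" and
    "T_acts p L I1 I1 lam1 \<xi>" "T_acts p L I2 I2 lam2 \<xi>" "T_acts p L I1 I2 0 \<xi>"
proof -
  obtain N where N: "submodule N (Yp p) (verma p lam1 lam2)"
    and L: "L = quot_module (verma p lam1 lam2) N" "irreducible_module (Yp p) L"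
    and \<xi>: "\<xi> = N +>\<^bsub>verma p lam1 lam2\<^esub> verma_vec p lam1 lam2"
    using assms unfolding irreducible_quotient_of_verma_def by blast
  interpret Y: ring "Yp p" by (rule ring_Yp)
  let ?R = "regular_module (Yp p)" and ?V = "verma_ideal p lam1 lam2"
  let ?M = "verma p lam1 lam2" and ?v = "verma_vec p lam1 lam2"
  let ?S = "range (T_coeff p I1 I2)
        \<union> range (\<lambda>k. T_coeff p I1 I1 k \<ominus>\<^bsub>Yp p\<^esub> Yp_scalar p (poly.coeff lam1 k))
        \<union> range (\<lambda>k. T_coeff p I2 I2 k \<ominus>\<^bsub>Yp p\<^esub> Yp_scalar p (poly.coeff lam2 k))"
  interpret R: left_module "Yp p" ?R by (rule Y.left_module_regular_module)
  have R: "carrier ?R = carrier (Yp p)" "\<And>a b. a \<odot>\<^bsub>?R\<^esub> b = a \<otimes>\<^bsub>Yp p\<^esub> b"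
    by (simp_all add: regular_module_def)
  have V: "submodule ?V (Yp p) ?R"
    unfolding verma_ideal_def
    by (rule Y.submodule_left_ideal_gen)
      (auto simp: T_coeff_closed Yp_scalar_closed intro!: Y.minus_closed)
  interpret V: abelian_subgroup ?V ?R by (rule R.submodule_abelian_subgroup[OF V])
  interpret M: left_module "Yp p" ?M
    unfolding verma_def by (rule R.left_module_quot_module[OF V])
  interpret N: abelian_subgroup N ?M by (rule M.submodule_abelian_subgroup[OF N])
  interpret L: left_module "Yp p" L
    unfolding L(1) by (rule M.left_module_quot_module[OF N])
  have M_car: "carrier ?M = a_rcosets\<^bsub>?R\<^esub> ?V" and M_zero: "\<zero>\<^bsub>?M\<^esub> = ?V"
    by (simp_all add: verma_def quot_module_def)
  have L_car: "carrier L = a_rcosets\<^bsub>?M\<^esub> N" and L_zero: "\<zero>\<^bsub>L\<^esub> = N"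
    by (simp_all add: L(1) quot_module_def)
  have v_closed: "?v \<in> carrier ?M"
    unfolding M_car verma_vec_def by (intro R.M.a_rcosetsI V.a_subset) (simp add: R)
  then have \<xi>_closed: "\<xi> \<in> carrier L"
    unfolding L_car \<xi> by (intro M.M.a_rcosetsI N.a_subset)
  show "Yp_module p L \<xi>"
    using \<xi>_closed by (intro Yp_module.intro Yp_module_axioms.intro L.left_module_axioms)
  have act_v: "a \<odot>\<^bsub>?M\<^esub> ?v = ?V +>\<^bsub>?R\<^esub> a" if "a \<in> carrier (Yp p)" for a
    using R.smult_quot_module[OF V that, of "\<one>\<^bsub>Yp p\<^esub>"] that
    by (simp add: verma_def verma_vec_def R)
  have act_\<xi>: "a \<odot>\<^bsub>L\<^esub> \<xi> = N +>\<^bsub>?M\<^esub> (a \<odot>\<^bsub>?M\<^esub> ?v)" if "a \<in> carrier (Yp p)" for a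
    using M.smult_quot_module[OF N that v_closed] by (simp add: L(1) \<xi>)
  show "\<xi> \<noteq> \<zero>\<^bsub>L\<^esub>"
  proof
    assume zero: "\<xi> = \<zero>\<^bsub>L\<^esub>"
    have "A = \<zero>\<^bsub>L\<^esub>" if "A \<in> carrier L" for A
    proof -
      obtain y where y: "y \<in> carrier ?M" "A = N +>\<^bsub>?M\<^esub> y"
        using \<open>A \<in> carrier L\<close> by (auto simp: L_car A_RCOSETS_def')
      then obtain a where a: "a \<in> carrier (Yp p)" "y = ?V +>\<^bsub>?R\<^esub> a"
        by (auto simp: M_car A_RCOSETS_def' R)
      have "A = a \<odot>\<^bsub>L\<^esub> \<xi>" using act_\<xi> act_v a y by simp
      then show ?thesis using L.smult_zero_right[OF a(1)] zero by simp
    qed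
    then have "carrier L = {\<zero>\<^bsub>L\<^esub>}" by blast
    then show False using L(2) by (simp add: irreducible_module_def)
  qed
  have kill: "a \<odot>\<^bsub>L\<^esub> \<xi> = \<zero>\<^bsub>L\<^esub>" if a: "a \<in> ?S" for a
  proof -
    have aV: "a \<in> ?V" using a Y.left_ideal_gen_superset[of ?S] by (auto simp: verma_ideal_def)
    then have aY: "a \<in> carrier (Yp p)" using V.a_subset R by auto
    have "a \<odot>\<^bsub>?M\<^esub> ?v = \<zero>\<^bsub>?M\<^esub>" using act_v[OF aY] V.a_rcos_const[OF aV] M_zero by simp
    then show ?thesis using act_\<xi>[OF aY] N.a_rcos_const[OF N.zero_closed] L_zero by simp
  qed
  have diag: "T_coeff p i i k \<odot>\<^bsub>L\<^esub> \<xi> = Yp_scalar p c \<odot>\<^bsub>L\<^esub> \<xi>"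
    if "T_coeff p i i k \<ominus>\<^bsub>Yp p\<^esub> Yp_scalar p c \<in> ?S" for i k c
    using kill[OF that] L.smult_eq_if_minus_kills[OF T_coeff_closed Yp_scalar_closed \<xi>_closed] by blast
  show "T_acts p L I1 I1 lam1 \<xi>" "T_acts p L I2 I2 lam2 \<xi>"
    unfolding T_acts_def by (intro allI diag; blast)+
  have "Yp_scalar p 0 = \<zero>\<^bsub>Yp p\<^esub>" by (simp add: Yp_scalar_def Yp_proj_simps)
  then show "T_acts p L I1 I2 0 \<xi>"
    unfolding T_acts_def using kill[OF UnI1[OF UnI1[OF rangeI]]] L.smult_zero_left[OF \<xi>_closed]
    by simp
qed

section \<open>The free algebra as a model of a cyclic module\<close>

text \<open>
  \<open>\<pi>\<close> is the projection onto a complement of \<open>J\<close>: a basis of \<open>J\<close> is extended to a basis of the whole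
  space, and \<open>\<pi>\<close> kills the former and fixes the added basis vectors.
\<close>
lemma (in vector_space) projection_with_kernel:
  assumes J: "subspace J"
  obtains \<pi> where "Vector_Spaces.linear scale scale \<pi>" "\<And>x. \<pi> x = 0 \<longleftrightarrow> x \<in> J" "\<And>x. x - \<pi> x \<in> J"
proof -
  interpret vector_space_pair scale scale by unfold_locales
  obtain B where B: "B \<subseteq> J" "independent B" "J \<subseteq> span B"
    using maximal_independent_subset[of J] by blast
  obtain C where C: "B \<subseteq> C" "independent C" "UNIV \<subseteq> span C"
    by (rule maximal_independent_subset_extend[OF subset_UNIV B(2)])
  obtain \<pi> where \<pi>: "Vector_Spaces.linear scale scale \<pi>" "\<And>b. b \<in> C \<Longrightarrow> \<pi> b = (if b \<in> B then 0 else b)"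
    using linear_independent_extend[OF C(2), of "\<lambda>b. if b \<in> B then 0 else b"] by blast
  interpret \<pi>: module_hom scale scale \<pi>
    using \<pi>(1) unfolding module_hom_iff_linear .
  have diff: "x - \<pi> x \<in> J" for x
  proof -
    have "x \<in> span C" using C(3) by blast
    then show ?thesis
    proof (induction rule: span_induct)
      case base
      show ?case
      proof (rule subspaceI)
        show "0 \<in> {x. x - \<pi> x \<in> J}" using subspace_0[OF J] by (simp add: \<pi>.zero)
        show "x + y \<in> {x. x - \<pi> x \<in> J}" if "x \<in> {x. x - \<pi> x \<in> J}" "y \<in> {x. x - \<pi> x \<in> J}" for x y
          using subspace_add[OF J, of "x - \<pi> x" "y - \<pi> y"] that by (simp add: \<pi>.add add_diff_add)
        show "scale c x \<in> {x. x - \<pi> x \<in> J}" if "x \<in> {x. x - \<pi> x \<in> J}" for c x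
          using subspace_scale[OF J, of "x - \<pi> x" c] that
          by (simp add: \<pi>.scale scale_right_diff_distrib)
      qed
    next
      case (step b)
      then show ?case using \<pi>(2) B(1) subspace_0[OF J] by auto
    qed
  qed
  have "\<pi> x = 0" if "x \<in> J" for x
    by (rule \<pi>.eq_0_on_span[of B]) (use \<pi>(2) C(1) B(3) that in auto)
  moreover have "x \<in> J" if "\<pi> x = 0" for x
    using diff[of x] that by simp
  ultimately show thesis using that[OF \<pi>(1) _ diff] by blast
qed

definition scale_free :: "complex \<Rightarrow> gen free_alg \<Rightarrow> gen free_alg" where
  "scale_free c x = Poly_Mapping.single 0 c * x"

lemma vector_space_scale_free: "vector_space scale_free"
  by unfold_locales
    (simp_all add: scale_free_def distrib_left distrib_right single_add mult.assoc[symmetric] mult_single)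

lemma mult_t_free_scale_free: "t_free i j r * scale_free c x = scale_free c (t_free i j r * x)"
proof -
  have "t_free i j r * Poly_Mapping.single 0 c = Poly_Mapping.single 0 c * t_free i j r"
    by (cases r) (simp_all add: t_free_def mult_single)
  then show ?thesis by (simp add: scale_free_def mult.assoc[symmetric])
qed

lemma scale_free_minus_one_power: "scale_free ((- 1) ^ n) x = (- 1) ^ n * x"
proof -
  have "Poly_Mapping.single 0 ((- 1) ^ n) = ((- 1) ^ n :: gen free_alg)"
    by (induction n) (simp_all add: single_uminus)
  then show ?thesis by (simp add: scale_free_def)
qed

context Yp_module
begin

definition \<rho> :: "gen free_alg \<Rightarrow> 'v" where
  "\<rho> x = Yp_proj p x \<odot> \<xi>"

lemma \<rho>_closed: "\<rho> x \<in> carrier L"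
  by (simp add: \<rho>_def smult_closed Yp_proj_simps \<xi>_closed)

lemma \<rho>_zero: "\<rho> 0 = \<zero>"
  by (simp add: \<rho>_def Yp_proj_simps smult_zero_left \<xi>_closed)

lemma \<rho>_one: "\<rho> 1 = \<xi>"
  by (simp add: \<rho>_def Yp_proj_simps smult_one \<xi>_closed)

lemma \<rho>_add: "\<rho> (x + y) = \<rho> x \<oplus> \<rho> y"
  by (simp add: \<rho>_def Yp_proj_simps smult_l_distr \<xi>_closed)

lemma \<rho>_mult: "\<rho> (x * y) = Yp_proj p x \<odot> \<rho> y"
  by (simp add: \<rho>_def Yp_proj_simps smult_assoc \<xi>_closed)

lemma \<rho>_scale_free: "\<rho> (scale_free c x) = Yp_scalar p c \<odot> \<rho> x"
  by (simp add: scale_free_def \<rho>_mult Yp_scalar_def)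

lemma \<rho>_eq_iff: "\<rho> x = \<rho> y \<longleftrightarrow> \<rho> (x - y) = \<zero>"
proof -
  have "\<rho> x = \<rho> (x - y) \<oplus> \<rho> y"
    using \<rho>_add[of "x - y" y] by simp
  then show ?thesis
    using M.add.r_cancel_one[OF \<rho>_closed \<rho>_closed, of "x - y" y] by simp
qed

lemma \<rho>_sum_cong: "(\<And>a. a \<in> A \<Longrightarrow> \<rho> (f a) = \<rho> (g a)) \<Longrightarrow> \<rho> (sum f A) = \<rho> (sum g A)"
  by (induction A rule: infinite_finite_induct) (simp_all add: \<rho>_add)

sublocale free: vector_space scale_free
  by (rule vector_space_scale_free)

lemma subspace_ker_\<rho>: "free.subspace {x. \<rho> x = \<zero>}"
  by (rule free.subspaceI)
    (simp_all add: \<rho>_zero \<rho>_add \<rho>_scale_free smult_zero_right Yp_scalar_closed)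

text \<open>
  A choice of representatives that is linear: \<open>\<pi> x = \<pi> y\<close> holds exactly when \<open>\<rho> x = \<rho> y\<close>, so
  equations in \<open>L\<close> turn into equations between elements of the free algebra.
\<close>
definition \<pi> :: "gen free_alg \<Rightarrow> gen free_alg" where
  "\<pi> = (SOME \<pi>. Vector_Spaces.linear scale_free scale_free \<pi>
      \<and> (\<forall>x. \<pi> x = 0 \<longleftrightarrow> \<rho> x = \<zero>) \<and> (\<forall>x. \<rho> (x - \<pi> x) = \<zero>))"

lemma \<pi>_linear: "Vector_Spaces.linear scale_free scale_free \<pi>"
  and \<pi>_eq_0_iff: "\<pi> x = 0 \<longleftrightarrow> \<rho> x = \<zero>"
  and \<rho>_\<pi>: "\<rho> (\<pi> x) = \<rho> x"
proof -
  have "\<exists>\<pi>. Vector_Spaces.linear scale_free scale_free \<pi>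
      \<and> (\<forall>x. \<pi> x = 0 \<longleftrightarrow> \<rho> x = \<zero>) \<and> (\<forall>x. \<rho> (x - \<pi> x) = \<zero>)"
    by (rule free.projection_with_kernel[OF subspace_ker_\<rho>]) (use mem_Collect_eq in blast)
  from someI_ex[OF this, folded \<pi>_def]
  show "Vector_Spaces.linear scale_free scale_free \<pi>" "\<pi> x = 0 \<longleftrightarrow> \<rho> x = \<zero>" "\<rho> (\<pi> x) = \<rho> x"
    using \<rho>_eq_iff[of x "\<pi> x"] by auto
qed

sublocale \<pi>: module_hom scale_free scale_free \<pi>
  using \<pi>_linear unfolding module_hom_iff_linear .

lemma \<pi>_eq_iff: "\<pi> x = \<pi> y \<longleftrightarrow> \<rho> x = \<rho> y"
  using \<pi>_eq_0_iff[of "x - y"] \<rho>_eq_iff[of x y] by (simp add: \<pi>.diff)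

lemma \<pi>_\<pi>: "\<pi> (\<pi> x) = \<pi> x"
  by (simp add: \<pi>_eq_iff \<rho>_\<pi>)

lemma \<pi>_mult_\<pi>: "\<pi> (x * \<pi> y) = \<pi> (x * y)"
  by (simp add: \<pi>_eq_iff \<rho>_mult \<rho>_\<pi>)

text \<open>
  For \<open>r = 0\<close> the operator is the identity or zero on the whole free algebra, and not its composition with
  \<open>\<pi>\<close>: this is what the constant term of a representation has to be.
\<close>
definition act :: "idx \<Rightarrow> idx \<Rightarrow> nat \<Rightarrow> gen free_alg \<Rightarrow> gen free_alg" where
  "act i j r x = (if r = 0 then (if i = j then x else 0) else \<pi> (t_free i j r * x))"

lemma act_act:
  assumes "r > 0 \<or> s > 0"
  shows "act i j r (act k l s x) = \<pi> (t_free i j r * (t_free k l s * x))"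
  using assms by (auto simp: act_def t_free_def \<pi>_mult_\<pi> \<pi>.zero)

lemma yangian_rep_act: "yangian_rep scale_free p act"
proof (intro yangian_rep.intro yangian_rep_axioms.intro vector_space_scale_free)
  show "Vector_Spaces.linear scale_free scale_free (act i j r)" for i j r
    unfolding Vector_Spaces.linear_iff
    by (auto simp: vector_space_scale_free act_def distrib_left \<pi>.add \<pi>.scale mult_t_free_scale_free)
  show "act i j 0 x = (if i = j then x else 0)" for i j x
    by (simp add: act_def)
  show "act i j r x = 0" if "p < r" for i j r x
    using that
    by (simp add: act_def \<pi>_eq_0_iff \<rho>_mult Yp_proj_above_level smult_zero_left \<rho>_closed)
  show "act i j (Suc r) (act k l s x)
      - scale_free ((- 1) ^ ((par i + par j) * (par k + par l))) (act k l s (act i j (Suc r) x))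
      - (act i j r (act k l (Suc s) x)
      - scale_free ((- 1) ^ ((par i + par j) * (par k + par l))) (act k l (Suc s) (act i j r x)))
      = scale_free ((- 1) ^ (par i * par j + par i * par k + par j * par k))
          (act k j r (act i l s x) - act k j s (act i l r x))" for i j r k l s x
  proof -
    define \<epsilon> :: complex where "\<epsilon> = (- 1) ^ ((par i + par j) * (par k + par l))"
    define \<delta> :: complex where "\<delta> = (- 1) ^ (par i * par j + par i * par k + par j * par k)"
    \<comment> \<open>For \<open>r = s = 0\<close> the products of operators differ from those in the free algebra by \<open>\<pi>\<close>, but the
      difference on the right-hand side is then zero.\<close>
    have rhs: "act k j r (act i l s x) - act k j s (act i l r x)
        = \<pi> (t_free k j r * (t_free i l s * x)) - \<pi> (t_free k j s * (t_free i l r * x))"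
      by (cases "r = 0 \<and> s = 0") (auto simp: act_act)
    have "\<pi> (yangian_relator i j k l r s * x) = 0"
      by (simp add: \<pi>_eq_0_iff \<rho>_mult Yp_proj_relator smult_zero_left \<rho>_closed)
    also have "yangian_relator i j k l r s * x
      = (t_free i j (Suc r) * (t_free k l s * x) - scale_free \<epsilon> (t_free k l s * (t_free i j (Suc r) * x)))
      - (t_free i j r * (t_free k l (Suc s) * x) - scale_free \<epsilon> (t_free k l (Suc s) * (t_free i j r * x)))
      - scale_free \<delta> (t_free k j r * (t_free i l s * x) - t_free k j s * (t_free i l r * x))"
      unfolding \<epsilon>_def \<delta>_def
      by (simp only: scale_free_minus_one_power yangian_relator_def t_scomm_def left_diff_distrib mult.assoc)
    finally show ?thesis
      unfolding \<epsilon>_def[symmetric] \<delta>_def[symmetric] rhs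
      by (simp add: act_act \<pi>.diff \<pi>.scale)
  qed
qed

sublocale rep: yangian_rep scale_free p act
  by (rule yangian_rep_act)

lemma \<rho>_act: "\<rho> (act i j r x) = Yp_proj p (t_free i j r) \<odot> \<rho> x"
  by (auto simp: act_def \<rho>_\<pi> \<rho>_mult[symmetric] t_free_def)

lemma T_eval_eq_Yp_proj:
  "T_eval p i j c = Yp_proj p (\<Sum>k\<le>p. Poly_Mapping.single 0 (c ^ k) * t_free i j (p - k))"
proof -
  have sum: "finite A \<Longrightarrow> Yp_proj p (sum f A) = (\<Oplus>\<^bsub>Yp p\<^esub>k\<in>A. Yp_proj p (f k))" for f and A :: "nat set"
    by (induction A rule: finite_induct) (simp_all add: Yp_proj_simps Pi_def)
  show ?thesis
    unfolding T_eval_def sum[OF finite_atMost]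
    by (intro R.add.finprod_cong') (auto simp: T_coeff_def Yp_scalar_def Yp_proj_simps)
qed

lemma \<rho>_T: "\<rho> (rep.T i j u x) = T_eval p i j u \<odot> \<rho> x"
  unfolding T_eval_eq_Yp_proj \<rho>_mult[symmetric] rep.T_def sum_distrib_right
  by (rule \<rho>_sum_cong) (simp add: \<rho>_scale_free \<rho>_act \<rho>_mult mult.assoc Yp_scalar_def)

lemma \<pi>_act: "\<pi> x = x \<Longrightarrow> \<pi> (act i j r x) = act i j r x"
  by (simp add: act_def \<pi>_\<pi> \<pi>.zero)

lemma \<pi>_T: "\<pi> x = x \<Longrightarrow> \<pi> (rep.T i j u x) = rep.T i j u x"
  by (simp add: rep.T_def \<pi>.sum \<pi>.scale \<pi>_act)

text \<open>
  The transfer principle: on the range of \<open>\<pi>\<close> the map \<open>\<rho>\<close> is injective and intertwines the actions, so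
  the coefficientwise eigenvector condition in \<open>L\<close> is the eigenvector condition for the operators
  on the free algebra at all points \<open>u\<close>.
\<close>
lemma T_acts_\<rho>_iff:
  assumes x: "\<pi> x = x" and f: "Polynomial.degree f \<le> p"
  shows "T_acts p L i j f (\<rho> x) \<longleftrightarrow> (\<forall>u. rep.T i j u x = scale_free (poly f u) x)"
proof -
  have above: "T_coeff p i j k \<odot> \<rho> x = Yp_scalar p (poly.coeff f k) \<odot> \<rho> x" if "\<not> k \<le> p" for k
    using that f by (simp add: T_coeff_def coeff_eq_0 Yp_scalar_def Yp_proj_simps)
  have "T_coeff p i j k \<odot> \<rho> x = Yp_scalar p (poly.coeff f k) \<odot> \<rho> x
      \<longleftrightarrow> act i j (p - k) x = scale_free (poly.coeff f k) x" if "k \<le> p" for k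
    using \<pi>_eq_iff[of "act i j (p - k) x" "scale_free (poly.coeff f k) x"] that
    by (simp add: \<pi>_act x \<pi>.scale \<rho>_act \<rho>_scale_free T_coeff_def)
  then have "T_acts p L i j f (\<rho> x) \<longleftrightarrow> (\<forall>k\<le>p. act i j (p - k) x = scale_free (poly.coeff f k) x)"
    unfolding T_acts_def using above by metis
  also have "\<dots> \<longleftrightarrow> (\<forall>u. rep.T i j u x = scale_free (poly f u) x)"
    using rep.T_values_of_coeffs[of i j x f x] rep.T_coeffs_of_values[of i j x f x] f by blast
  finally show ?thesis .
qed

lemma \<rho>_lowering: "\<rho> (foldr (rep.T I2 I1) us x) = foldr (\<lambda>u. (\<odot>) (T_eval p I2 I1 u)) us (\<rho> x)"
  by (induction us) (simp_all add: \<rho>_T)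

lemma \<pi>_lowering: "\<pi> x = x \<Longrightarrow> \<pi> (foldr (rep.T I2 I1) us x) = foldr (rep.T I2 I1) us x"
  by (induction us) (simp_all add: \<pi>_T)

end

section \<open>The lowest vector of the irreducible module\<close>

lemma degree_prod_linear_le: "degree (\<Prod>i=1..p. [:f i, 1:]) \<le> p" for f :: "nat \<Rightarrow> complex"
  using degree_prod_sum_le[of "{1..p}" "\<lambda>i. [:f i, 1:]"] by simp

theorem proposition4p1:
  fixes p :: nat
    and \<alpha> \<beta> :: "nat \<Rightarrow> complex"
    and L :: "(yp, yp set set) module"
    and \<xi> \<zeta> :: "yp set set"
  assumes L: "irreducible_quotient_of_verma p
                (\<Prod>i=1..p. [:\<alpha> i, 1:]) (\<Prod>i=1..p. [:\<beta> i, 1:]) L \<xi>"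
    and alpha_beta: "\<And>i j. i \<in> {1..p} \<Longrightarrow> j \<in> {1..p} \<Longrightarrow> \<alpha> i \<noteq> \<beta> j"
    and alpha: "\<And>i j. 1 \<le> i \<Longrightarrow> i < j \<Longrightarrow> j \<le> p \<Longrightarrow> \<alpha> i - \<alpha> j + 1 \<noteq> 0"
    and zeta: "\<zeta> = foldr (\<lambda>i v. T_eval p I2 I1 (- \<alpha> i) \<odot>\<^bsub>L\<^esub> v) [1..<Suc p] \<xi>"
  shows "\<zeta> \<noteq> \<zero>\<^bsub>L\<^esub>
    \<and> T_acts p L I1 I1 (\<Prod>i=1..p. [:\<alpha> i - 1, 1:]) \<zeta>
    \<and> T_acts p L I2 I2 (\<Prod>i=1..p. [:\<beta> i - 1, 1:]) \<zeta>
    \<and> T_acts p L I2 I1 0 \<zeta>"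
proof -
  note hw = irreducible_quotient_of_vermaD[OF L]
  interpret Yp_module p L \<xi> by (rule hw(1))
  define x where "x = \<pi> 1"
  define as where "as = map \<alpha> [1..<Suc p]"
  let ?b = "\<Prod>i=1..p. [:\<beta> i, 1:]"
  have \<pi>x: "\<pi> x = x" and \<rho>x: "\<rho> x = \<xi>"
    by (simp_all add: x_def \<pi>_\<pi> \<rho>_\<pi> \<rho>_one)
  have roots: "shifted_roots_poly c as = (\<Prod>i=1..p. [:\<alpha> i + c, 1:])" for c
    unfolding shifted_roots_poly_def as_def
    using prod.distinct_set_conv_list[of "[1..<Suc p]" "\<lambda>i. [:\<alpha> i + c, 1:]"]
    by (simp add: o_def atLeastLessThanSuc_atLeastAtMost del: upt_Suc)
  interpret highest_weight_vector scale_free p act as ?b x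
  proof (intro highest_weight_vector.intro highest_weight_vector_axioms.intro yangian_rep_act)
    show "rep.T I1 I1 u x = scale_free (poly (shifted_roots_poly 0 as) u) x" for u
      using hw(3) T_acts_\<rho>_iff[OF \<pi>x degree_prod_linear_le, of I1 I1 \<alpha>] by (simp add: \<rho>x roots)
    show "rep.T I2 I2 u x = scale_free (poly ?b u) x" for u
      using hw(4) T_acts_\<rho>_iff[OF \<pi>x degree_prod_linear_le, of I2 I2 \<beta>] by (simp add: \<rho>x)
    show "rep.T I1 I2 u x = 0" for u
      using hw(5) T_acts_\<rho>_iff[OF \<pi>x, of 0 I1 I2] by (simp add: \<rho>x)
  qed
  have \<zeta>: "\<zeta> = \<rho> (\<eta> as)"
    unfolding zeta \<eta>_def \<rho>_lowering \<rho>x as_def by (simp add: foldr_map o_def del: upt_Suc)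
  have \<pi>\<eta>: "\<pi> (\<eta> as) = \<eta> as"
    unfolding \<eta>_def by (rule \<pi>_lowering[OF \<pi>x])
  have len: "length as = p" by (simp add: as_def)
  have "\<eta> as \<noteq> 0"
  proof (rule \<eta>_nonzero[of "[]"])
    show "x \<noteq> 0" using hw(2) \<rho>x \<rho>_zero by auto
    show "sorted_wrt (\<lambda>x y. x - y + 1 \<noteq> 0) as"
      using alpha by (auto simp: as_def sorted_wrt_map sorted_wrt_iff_nth_less simp del: upt_Suc)
    show "poly ?b (- a) \<noteq> 0" if a: "a \<in> set as" for a
    proof -
      obtain i where i: "i \<in> {1..p}" "a = \<alpha> i"
        using a by (force simp: as_def simp del: upt_Suc)
      have "\<beta> j \<noteq> \<alpha> i" if "j \<in> {1..p}" for j
        using alpha_beta[OF i(1) that] by metis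
      then show ?thesis by (auto simp: poly_prod i(2))
    qed
  qed simp
  then have "\<zeta> \<noteq> \<zero>\<^bsub>L\<^esub>"
    using \<pi>_eq_0_iff[of "\<eta> as"] by (simp add: \<zeta> \<pi>\<eta>)
  moreover have "T_acts p L I1 I1 (\<Prod>i=1..p. [:\<alpha> i - 1, 1:]) \<zeta>"
    unfolding \<zeta> T_acts_\<rho>_iff[OF \<pi>\<eta> degree_prod_linear_le] using T11_full_\<eta> by (simp add: roots)
  moreover have "T_acts p L I2 I2 (\<Prod>i=1..p. [:\<beta> i - 1, 1:]) \<zeta>"
    unfolding \<zeta> T_acts_\<rho>_iff[OF \<pi>\<eta> degree_prod_linear_le]
    using T22_full_\<eta>[OF len] by (simp add: poly_prod algebra_simps)
  moreover have "T_acts p L I2 I1 0 \<zeta>"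
    unfolding \<zeta> using T_acts_\<rho>_iff[OF \<pi>\<eta>, of 0] T21_full_\<eta>[OF len] by simp
  ultimately show ?thesis by blast
qed

end
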